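(* Let $R$ be a commutative Noetherian ring and let $M$ be a finitely generated $R$-module such that the trace ideal $\tau_M(R)$ has positive grade. Then $\operatorname{End}_R(\tau_M(R))$, $\operatorname{End}_R(\tau_{M^*}(R))$ and $Z(\operatorname{End}_R(M^* ))$ may be identified (in the way described in the context) with $R$-submodules of the total ring of quotients $Q(R)$, and under these identifications $$Z(\operatorname{End}_R(M^* )) = \operatorname{End}_R(\tau_M(R)) = \operatorname{End}_R(\tau_{M^*}(R))$$ as subsets of $Q(R)$.
   Context: For an $R$-module $N$ put $N^* = \operatorname{Hom}_R(N,R)$. The trace ideal of $N$ is $\tau_N(R) = \sum_{\alpha\in N^*}\alpha(N)\subseteq R$. The grade of an ideal $I$ of a Noetherian ring is the common length of the maximal $R$-regular sequences contained in $I$ (infinite if $I=R$); $I$ has positive grade iff it contains a nonzerodivisor of $R$. One has $\tau_M(R)\subseteq\tau_{M^*}(R)$, so both ideals contain a nonzerodivisor here. $Z(S)$ is the center of a ring $S$ and $Q(R)$ the total ring of quotients of $R$. Identifications. If an ideal $I$ contains a nonzerodivisor $x$, then $\operatorname{End}_R(I)$ is identified with $\{q\in Q(R): qI\subseteq I\}$ via $h\mapsto h(x)/x$ (independent of $x$). An endomorphism $f\in Z(\operatorname{End}_R(M^* ))$ is identified with the element $a/b\in Q(R)$ ($b$ a nonzerodivisor) such that $f$ is multiplication by $a/b$, i.e. $aM^*\subseteq bM^*$ and $b\,f(\alpha)=a\alpha$ for all $\alpha\in M^*$. *)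

theory Defs
  imports "HOL-Library.Extended_Nat" "HOL-Algebra.Module"
    "HOL-Algebra.QuotRing" "HOL-Algebra.Ring_Divisibility"
begin

text \<open>Homomorphisms are extensional functions (value \<^const>\<open>undefined\<close> off the carrier),
  so that equality of homomorphisms is equality in HOL.\<close>

definition module_hom ::
    "('a, 'r) ring_scheme \<Rightarrow> ('a, 'b, 'm) module_scheme \<Rightarrow> ('a, 'c, 'n) module_scheme \<Rightarrow> ('b \<Rightarrow> 'c) set"
  where "module_hom R M N =
    {f \<in> carrier M \<rightarrow>\<^sub>E carrier N.
       (\<forall>x\<in>carrier M. \<forall>y\<in>carrier M. f (x \<oplus>\<^bsub>M\<^esub> y) = f x \<oplus>\<^bsub>N\<^esub> f y) \<and>
       (\<forall>r\<in>carrier R. \<forall>x\<in>carrier M. f (r \<odot>\<^bsub>M\<^esub> x) = r \<odot>\<^bsub>N\<^esub> f x)}"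

text \<open>HOL-Algebra's module records extend ring records; the locale \<^locale>\<open>module\<close> ignores the
  multiplicative part, which is therefore left unspecified here.\<close>

definition Hom_module ::
    "('a, 'r) ring_scheme \<Rightarrow> ('a, 'b, 'm) module_scheme \<Rightarrow> ('a, 'c, 'n) module_scheme \<Rightarrow> ('a, 'b \<Rightarrow> 'c) module"
  where "Hom_module R M N =
    \<lparr>carrier = module_hom R M N,
     mult = undefined, one = undefined,
     zero = (\<lambda>x\<in>carrier M. \<zero>\<^bsub>N\<^esub>),
     add = (\<lambda>f g. \<lambda>x\<in>carrier M. f x \<oplus>\<^bsub>N\<^esub> g x),
     smult = (\<lambda>r f. \<lambda>x\<in>carrier M. r \<odot>\<^bsub>N\<^esub> f x)\<rparr>"

definition End_algebra ::
    "('a, 'r) ring_scheme \<Rightarrow> ('a, 'b, 'm) module_scheme \<Rightarrow> ('a, 'b \<Rightarrow> 'b) module"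
  where "End_algebra R N =
    (Hom_module R N N)
      \<lparr>mult := (\<lambda>g f. compose (carrier N) g f), one := (\<lambda>x\<in>carrier N. x)\<rparr>"

definition ideal_module :: "('a, 'r) ring_scheme \<Rightarrow> 'a set \<Rightarrow> ('a, 'a) module"
  where "ideal_module R I =
    \<lparr>carrier = I, mult = mult R, one = one R, zero = zero R, add = add R, smult = mult R\<rparr>"

definition dual_module ::
    "('a, 'r) ring_scheme \<Rightarrow> ('a, 'b, 'm) module_scheme \<Rightarrow> ('a, 'b \<Rightarrow> 'a) module"
  where "dual_module R M = Hom_module R M (ideal_module R (carrier R))"

definition ring_center :: "('b, 'm) ring_scheme \<Rightarrow> 'b set"
  where "ring_center S = {z \<in> carrier S. \<forall>s\<in>carrier S. z \<otimes>\<^bsub>S\<^esub> s = s \<otimes>\<^bsub>S\<^esub> z}"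

definition fin_gen_module :: "('a, 'r) ring_scheme \<Rightarrow> ('a, 'b, 'm) module_scheme \<Rightarrow> bool"
  where "fin_gen_module R M \<longleftrightarrow>
    (\<exists>G. finite G \<and> G \<subseteq> carrier M \<and>
      (\<forall>x\<in>carrier M. \<exists>c. c \<in> G \<rightarrow> carrier R \<and> x = (\<Oplus>\<^bsub>M\<^esub>g\<in>G. c g \<odot>\<^bsub>M\<^esub> g)))"

text \<open>The sum of the ideals \<open>\<alpha>(M)\<close>, \<open>\<alpha> \<in> M\<^sup>*\<close>, as the set of all finite sums.\<close>

definition trace_ideal :: "('a, 'r) ring_scheme \<Rightarrow> ('a, 'b, 'm) module_scheme \<Rightarrow> 'a set"
  where "trace_ideal R M =
    {(\<Oplus>\<^bsub>R\<^esub>\<alpha>\<in>F. t \<alpha>) | F t.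
       finite F \<and> F \<subseteq> carrier (dual_module R M) \<and> (\<forall>\<alpha>\<in>F. t \<alpha> \<in> \<alpha> ` carrier M)}"

definition nonzerodivisors :: "('a, 'r) ring_scheme \<Rightarrow> 'a set"
  where "nonzerodivisors R =
    {b \<in> carrier R. \<forall>x\<in>carrier R. b \<otimes>\<^bsub>R\<^esub> x = \<zero>\<^bsub>R\<^esub> \<longrightarrow> x = \<zero>\<^bsub>R\<^esub>}"

definition regular_sequence :: "('a, 'r) ring_scheme \<Rightarrow> 'a list \<Rightarrow> bool"
  where "regular_sequence R xs \<longleftrightarrow>
    set xs \<subseteq> carrier R \<and>
    (\<forall>i<length xs. let J = Idl\<^bsub>R\<^esub> (set (take i xs)) in
       J +>\<^bsub>R\<^esub> (xs ! i) \<in> nonzerodivisors (R Quot J)) \<and>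
    Idl\<^bsub>R\<^esub> (set xs) \<noteq> carrier R"

definition maximal_regular_sequence_in :: "('a, 'r) ring_scheme \<Rightarrow> 'a set \<Rightarrow> 'a list \<Rightarrow> bool"
  where "maximal_regular_sequence_in R I xs \<longleftrightarrow>
    regular_sequence R xs \<and> set xs \<subseteq> I \<and> (\<forall>y\<in>I. \<not> regular_sequence R (xs @ [y]))"

text \<open>Over a Noetherian ring the maximal regular sequences in a proper ideal exist and all have
  the same length, so that the description below is proper.\<close>

definition grade :: "('a, 'r) ring_scheme \<Rightarrow> 'a set \<Rightarrow> enat"
  where "grade R I =
    (if I = carrier R then \<infinity>
     else enat (THE n. \<exists>xs. maximal_regular_sequence_in R I xs \<and> length xs = n))"

text \<open>The class of \<open>(a, b)\<close> under \<open>(a, b) \<sim> (c, d) \<longleftrightarrow> a d = c b\<close>; since only nonzerodivisors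
  occur as denominators, this is already an equivalence relation.\<close>

definition fraction :: "('a, 'r) ring_scheme \<Rightarrow> 'a \<Rightarrow> 'a \<Rightarrow> ('a \<times> 'a) set"
  where "fraction R a b =
    {(c, d). c \<in> carrier R \<and> d \<in> nonzerodivisors R \<and> a \<otimes>\<^bsub>R\<^esub> d = c \<otimes>\<^bsub>R\<^esub> b}"

text \<open>In the operations, the unions are over representatives of the classes \<open>p\<close> and \<open>q\<close>; all members
  of such a union coincide.\<close>

definition total_quotient :: "('a, 'r) ring_scheme \<Rightarrow> ('a, ('a \<times> 'a) set) module"
  where "total_quotient R =
    \<lparr>carrier = {fraction R a b | a b. a \<in> carrier R \<and> b \<in> nonzerodivisors R},
     mult = (\<lambda>p q. \<Union>(a, b)\<in>p. \<Union>(c, d)\<in>q. fraction R (a \<otimes>\<^bsub>R\<^esub> c) (b \<otimes>\<^bsub>R\<^esub> d)),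
     one = fraction R \<one>\<^bsub>R\<^esub> \<one>\<^bsub>R\<^esub>,
     zero = fraction R \<zero>\<^bsub>R\<^esub> \<one>\<^bsub>R\<^esub>,
     add = (\<lambda>p q. \<Union>(a, b)\<in>p. \<Union>(c, d)\<in>q.
              fraction R (a \<otimes>\<^bsub>R\<^esub> d \<oplus>\<^bsub>R\<^esub> c \<otimes>\<^bsub>R\<^esub> b) (b \<otimes>\<^bsub>R\<^esub> d)),
     smult = (\<lambda>r q. \<Union>(c, d)\<in>q. fraction R (r \<otimes>\<^bsub>R\<^esub> c) d)\<rparr>"

definition multiplier_set :: "('a, 'r) ring_scheme \<Rightarrow> 'a set \<Rightarrow> ('a \<times> 'a) set set"
  where "multiplier_set R I =
    {q \<in> carrier (total_quotient R).
       \<forall>y\<in>I. \<exists>z\<in>I. q \<otimes>\<^bsub>total_quotient R\<^esub> fraction R y \<one>\<^bsub>R\<^esub> = fraction R z \<one>\<^bsub>R\<^esub>}"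

text \<open>An identification is given by a relation \<open>P h q\<close>, read ``\<open>h\<close> is identified with \<open>q\<close>''.
  The following says that \<open>P\<close> is the graph of an injective \<open>R\<close>-linear map into \<open>Q(R)\<close>; in
  particular each \<open>h\<close> is identified with exactly one \<open>q\<close>, whatever choices \<open>P\<close> involves.\<close>

definition is_identification ::
    "('a, 'r) ring_scheme \<Rightarrow> ('a, 'c, 'm) module_scheme \<Rightarrow> ('c \<Rightarrow> ('a \<times> 'a) set \<Rightarrow> bool) \<Rightarrow> bool"
  where "is_identification R A P \<longleftrightarrow>
    module R A \<and> module R (total_quotient R) \<and>
    (\<exists>\<phi>\<in>module_hom R A (total_quotient R).
       inj_on \<phi> (carrier A) \<and> (\<forall>h\<in>carrier A. \<forall>q. P h q \<longleftrightarrow> q = \<phi> h))"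

definition identified_subset ::
    "('a, 'c, 'm) module_scheme \<Rightarrow> ('c \<Rightarrow> ('a \<times> 'a) set \<Rightarrow> bool) \<Rightarrow> ('a \<times> 'a) set set"
  where "identified_subset A P = {q. \<exists>h\<in>carrier A. P h q}"

definition End_ideal_frac :: "('a, 'r) ring_scheme \<Rightarrow> 'a set \<Rightarrow> ('a \<Rightarrow> 'a) \<Rightarrow> ('a \<times> 'a) set \<Rightarrow> bool"
  where "End_ideal_frac R I h q \<longleftrightarrow> (\<exists>x\<in>I \<inter> nonzerodivisors R. q = fraction R (h x) x)"

definition is_mult_by ::
    "('a, 'r) ring_scheme \<Rightarrow> ('a, 'b, 'm) module_scheme \<Rightarrow> ('b \<Rightarrow> 'b) \<Rightarrow> ('a \<times> 'a) set \<Rightarrow> bool"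
  where "is_mult_by R N f q \<longleftrightarrow>
    (\<exists>a\<in>carrier R. \<exists>b\<in>nonzerodivisors R. q = fraction R a b \<and>
       (\<lambda>v. a \<odot>\<^bsub>N\<^esub> v) ` carrier N \<subseteq> (\<lambda>v. b \<odot>\<^bsub>N\<^esub> v) ` carrier N \<and>
       (\<forall>v\<in>carrier N. b \<odot>\<^bsub>N\<^esub> f v = a \<odot>\<^bsub>N\<^esub> v))"

definition center_End :: "('a, 'r) ring_scheme \<Rightarrow> ('a, 'b, 'm) module_scheme \<Rightarrow> ('a, 'b \<Rightarrow> 'b) module"
  where "center_End R N = (End_algebra R N)\<lparr>carrier := ring_center (End_algebra R N)\<rparr>"

definition End_ideal_in_Q :: "('a, 'r) ring_scheme \<Rightarrow> 'a set \<Rightarrow> ('a \<times> 'a) set set"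
  where "End_ideal_in_Q R I =
    identified_subset (End_algebra R (ideal_module R I)) (End_ideal_frac R I)"

definition center_End_in_Q ::
    "('a, 'r) ring_scheme \<Rightarrow> ('a, 'b, 'm) module_scheme \<Rightarrow> ('a \<times> 'a) set set"
  where "center_End_in_Q R N = identified_subset (center_End R N) (is_mult_by R N)"

end

theory Submission
  imports Defs
begin

text \<open>An element \<open>a / b\<close> of \<open>Q(R)\<close> acts on a torsion-free module \<open>N\<close> precisely when
  \<open>a N \<subseteq> b N\<close>, and this action is automatically central in \<open>End\<^sub>R(N)\<close>. If moreover every
  (central) endomorphism of the faithful module \<open>N\<close> arises in this way, the endomorphisms are
  identified with the set of such fractions. For an ideal with nonzerodivisor \<open>x\<close>, the
  endomorphism \<open>h\<close> is multiplication by \<open>h(x) / x\<close>; for \<open>M\<^sup>*\<close>, a central \<open>f\<close> satisfies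
  \<open>\<alpha>(m) f(\<beta>) = f(\<alpha>)(m) \<beta>\<close>, and writing a nonzerodivisor of \<open>\<tau>\<^sub>M(R)\<close> as
  \<open>x = \<Sum> \<alpha>\<^sub>i(m\<^sub>i)\<close> shows that \<open>f\<close> is multiplication by \<open>\<Sum> f(\<alpha>\<^sub>i)(m\<^sub>i) / x\<close>.
  Finally the fractions acting on \<open>M\<^sup>*\<close>, on \<open>\<tau>\<^sub>M(R)\<close> and on the trace ideal of \<open>M\<^sup>*\<close>
  agree: an action on \<open>M\<^sup>*\<close> passes to both trace ideals, while \<open>a \<tau>\<^sub>M(R) \<subseteq> b R\<close> already
  suffices to divide every \<open>a \<alpha>\<close> by \<open>b\<close> in \<open>M\<^sup>*\<close>.\<close>

section \<open>The total ring of quotients\<close>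

context cring
begin

lemma nzd_closed: "b \<in> nonzerodivisors R \<Longrightarrow> b \<in> carrier R"
  by (simp add: nonzerodivisors_def)

lemma nzd_cancel:
  assumes "b \<in> nonzerodivisors R" "x \<in> carrier R" "y \<in> carrier R" "b \<otimes> x = b \<otimes> y"
  shows "x = y"
proof -
  have b: "b \<in> carrier R" using assms(1) by (rule nzd_closed)
  have "b \<otimes> (x \<ominus> y) = \<zero>"
    using b assms by (simp add: r_distr r_minus r_neg a_minus_def)
  then have "x \<ominus> y = \<zero>"
    using assms unfolding nonzerodivisors_def by simp
  then show ?thesis using assms(2,3) by simp
qed

lemma nzd_one: "\<one> \<in> nonzerodivisors R"
  by (simp add: nonzerodivisors_def)

lemma nzd_mult:
  assumes "b \<in> nonzerodivisors R" "d \<in> nonzerodivisors R"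
  shows "b \<otimes> d \<in> nonzerodivisors R"
proof -
  have cl: "b \<in> carrier R" "d \<in> carrier R" using assms by (simp_all add: nzd_closed)
  have "x = \<zero>" if x: "x \<in> carrier R" and "b \<otimes> d \<otimes> x = \<zero>" for x
  proof -
    have "b \<otimes> (d \<otimes> x) = \<zero>" using that cl by (simp add: m_assoc)
    then have "d \<otimes> x = \<zero>" using assms(1) x cl unfolding nonzerodivisors_def by blast
    then show ?thesis using assms(2) x unfolding nonzerodivisors_def by blast
  qed
  then show ?thesis using m_closed[OF cl] unfolding nonzerodivisors_def by blast
qed

text \<open>Each class contains its own representative, which gives one direction. The other is
  transitivity of cross-multiplication, where the shared denominator cancels because it is a
  nonzerodivisor.\<close>

lemma fraction_eq_iff:
  assumes "a \<in> carrier R" "c \<in> carrier R" "b \<in> nonzerodivisors R" "d \<in> nonzerodivisors R"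
  shows "fraction R a b = fraction R c d \<longleftrightarrow> a \<otimes> d = c \<otimes> b"
proof
  assume "fraction R a b = fraction R c d"
  moreover have "(c, d) \<in> fraction R c d"
    using assms by (simp add: fraction_def)
  ultimately show "a \<otimes> d = c \<otimes> b"
    unfolding fraction_def by auto
next
  \<comment> \<open>Inclusion is proved for arbitrary representatives because it is needed a second
    time with the two fractions exchanged. Both products are compared after multiplication by
    \<open>b\<close>, which is then cancelled.\<close>
  have *: "fraction R a b \<subseteq> fraction R c d"
    if "a \<otimes> d = c \<otimes> b" "a \<in> carrier R" "c \<in> carrier R"
      "b \<in> nonzerodivisors R" "d \<in> nonzerodivisors R" for a b c d
  proof (clarsimp simp: fraction_def)
    fix e f assume e: "e \<in> carrier R" and f: "f \<in> nonzerodivisors R" and "a \<otimes> f = e \<otimes> b"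
    note cl = that(2,3) nzd_closed[OF that(4)] nzd_closed[OF that(5)] e nzd_closed[OF f]
    have "b \<otimes> (c \<otimes> f) = (c \<otimes> b) \<otimes> f" using cl by (simp add: m_ac)
    also have "\<dots> = (a \<otimes> f) \<otimes> d" using cl by (simp add: that(1)[symmetric] m_ac)
    also have "\<dots> = b \<otimes> (e \<otimes> d)" using cl by (simp add: \<open>a \<otimes> f = e \<otimes> b\<close> m_ac)
    finally show "c \<otimes> f = e \<otimes> d"
      using nzd_cancel[OF that(4)] cl by simp
  qed
  assume "a \<otimes> d = c \<otimes> b"
  then show "fraction R a b = fraction R c d"
    using *[of a d c b] *[of c b a d] assms by auto
qed

lemma fraction_self: "a \<in> carrier R \<Longrightarrow> b \<in> nonzerodivisors R \<Longrightarrow> (a, b) \<in> fraction R a b"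
  by (simp add: fraction_def)

lemma fraction_memD:
  assumes "(c, d) \<in> fraction R a b"
  shows "c \<in> carrier R" "d \<in> nonzerodivisors R" "d \<in> carrier R" "a \<otimes> d = c \<otimes> b"
  using assms nzd_closed by (auto simp: fraction_def)

lemma fraction_closed [intro]:
  "a \<in> carrier R \<Longrightarrow> b \<in> nonzerodivisors R \<Longrightarrow> fraction R a b \<in> carrier (total_quotient R)"
  by (auto simp: total_quotient_def)

lemma total_quotientE:
  assumes "q \<in> carrier (total_quotient R)"
  obtains a b where "a \<in> carrier R" "b \<in> nonzerodivisors R" "q = fraction R a b"
  using assms by (auto simp: total_quotient_def)

text \<open>The operations of \<open>total_quotient\<close> are unions over all representatives.
  Once the body is known not to depend on the representative, the union collapses to that value; it
  is nonempty since \<open>(a, b)\<close> itself lies in the class.\<close>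

lemma UN_fraction_const:
  assumes "a \<in> carrier R" "b \<in> nonzerodivisors R"
    and "\<And>a' b'. (a', b') \<in> fraction R a b \<Longrightarrow> X a' b' = Y"
  shows "(\<Union>(a', b')\<in>fraction R a b. X a' b') = Y"
proof -
  have "(case z of (a', b') \<Rightarrow> X a' b') = Y" if "z \<in> fraction R a b" for z
    using that assms(3) by (cases z) simp
  then have "(\<Union>(a', b')\<in>fraction R a b. X a' b') = (\<Union>z\<in>fraction R a b. Y)"
    by (rule SUP_cong[OF refl])
  also have "\<dots> = Y" using fraction_self[OF assms(1,2)] by blast
  finally show ?thesis .
qed

section \<open>Arithmetic of fractions\<close>

lemma total_quotient_mult:
  assumes a: "a \<in> carrier R" and b: "b \<in> nonzerodivisors R"
    and c: "c \<in> carrier R" and d: "d \<in> nonzerodivisors R"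
  shows "fraction R a b \<otimes>\<^bsub>total_quotient R\<^esub> fraction R c d = fraction R (a \<otimes> c) (b \<otimes> d)"
  unfolding total_quotient_def monoid.simps
proof (intro UN_fraction_const a b c d)
  fix a' b' c' d' assume 1: "(a', b') \<in> fraction R a b" and 2: "(c', d') \<in> fraction R c d"
  note D = fraction_memD[OF 1] fraction_memD[OF 2]
  note cl = a c nzd_closed[OF b] nzd_closed[OF d] D(1,3,5,7)
  have "a' \<otimes> c' \<otimes> (b \<otimes> d) = (a' \<otimes> b) \<otimes> (c' \<otimes> d)" using cl by (simp add: m_ac)
  also have "\<dots> = (a \<otimes> b') \<otimes> (c \<otimes> d')" using D by simp
  also have "\<dots> = a \<otimes> c \<otimes> (b' \<otimes> d')" using cl by (simp add: m_ac)
  finally show "fraction R (a' \<otimes> c') (b' \<otimes> d') = fraction R (a \<otimes> c) (b \<otimes> d)"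
    using cl b d D by (simp add: fraction_eq_iff nzd_mult)
qed

lemma total_quotient_add:
  assumes a: "a \<in> carrier R" and b: "b \<in> nonzerodivisors R"
    and c: "c \<in> carrier R" and d: "d \<in> nonzerodivisors R"
  shows "fraction R a b \<oplus>\<^bsub>total_quotient R\<^esub> fraction R c d
    = fraction R (a \<otimes> d \<oplus> c \<otimes> b) (b \<otimes> d)"
  unfolding total_quotient_def ring.simps
proof (intro UN_fraction_const a b c d)
  fix a' b' c' d' assume 1: "(a', b') \<in> fraction R a b" and 2: "(c', d') \<in> fraction R c d"
  note D = fraction_memD[OF 1] fraction_memD[OF 2]
  note cl = a c nzd_closed[OF b] nzd_closed[OF d] D(1,3,5,7)
  have "(a' \<otimes> d' \<oplus> c' \<otimes> b') \<otimes> (b \<otimes> d) = (a' \<otimes> b) \<otimes> (d' \<otimes> d) \<oplus> (c' \<otimes> d) \<otimes> (b' \<otimes> b)"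
    using cl by (simp add: l_distr r_distr m_ac)
  also have "\<dots> = (a \<otimes> b') \<otimes> (d' \<otimes> d) \<oplus> (c \<otimes> d') \<otimes> (b' \<otimes> b)" using D by simp
  also have "\<dots> = (a \<otimes> d \<oplus> c \<otimes> b) \<otimes> (b' \<otimes> d')" using cl by (simp add: l_distr r_distr m_ac)
  finally show "fraction R (a' \<otimes> d' \<oplus> c' \<otimes> b') (b' \<otimes> d')
      = fraction R (a \<otimes> d \<oplus> c \<otimes> b) (b \<otimes> d)"
    using cl b d D by (simp add: fraction_eq_iff nzd_mult)
qed

lemma total_quotient_smult:
  assumes r: "r \<in> carrier R" and c: "c \<in> carrier R" and d: "d \<in> nonzerodivisors R"
  shows "r \<odot>\<^bsub>total_quotient R\<^esub> fraction R c d = fraction R (r \<otimes> c) d"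
  unfolding total_quotient_def module.simps
proof (intro UN_fraction_const c d)
  fix c' d' assume 1: "(c', d') \<in> fraction R c d"
  note D = fraction_memD[OF 1]
  note cl = r c nzd_closed[OF d] D(1,3)
  have "r \<otimes> c' \<otimes> d = r \<otimes> (c' \<otimes> d)" using cl by (simp add: m_ac)
  also have "\<dots> = r \<otimes> c \<otimes> d'" using cl D by (simp add: D(4)[symmetric] m_ac)
  finally show "fraction R (r \<otimes> c') d' = fraction R (r \<otimes> c) d"
    using cl d D by (simp add: fraction_eq_iff)
qed

lemma total_quotient_zero: "\<zero>\<^bsub>total_quotient R\<^esub> = fraction R \<zero> \<one>"
  by (simp add: total_quotient_def)

lemma module_total_quotient: "module R (total_quotient R)"
proof (rule moduleI)
  show "abelian_group (total_quotient R)"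
  proof (rule abelian_groupI)
    fix x y assume "x \<in> carrier (total_quotient R)" "y \<in> carrier (total_quotient R)"
    then show "x \<oplus>\<^bsub>total_quotient R\<^esub> y \<in> carrier (total_quotient R)"
      by (elim total_quotientE) (auto simp: total_quotient_add nzd_mult nzd_closed)
  next
    show "\<zero>\<^bsub>total_quotient R\<^esub> \<in> carrier (total_quotient R)"
      by (auto simp: total_quotient_zero nzd_one)
  next
    fix x y z assume "x \<in> carrier (total_quotient R)" "y \<in> carrier (total_quotient R)"
      "z \<in> carrier (total_quotient R)"
    then show "x \<oplus>\<^bsub>total_quotient R\<^esub> y \<oplus>\<^bsub>total_quotient R\<^esub> z
        = x \<oplus>\<^bsub>total_quotient R\<^esub> (y \<oplus>\<^bsub>total_quotient R\<^esub> z)"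
      by (elim total_quotientE)
        (simp add: total_quotient_add nzd_mult nzd_closed l_distr r_distr m_ac a_ac)
  next
    fix x y assume "x \<in> carrier (total_quotient R)" "y \<in> carrier (total_quotient R)"
    then show "x \<oplus>\<^bsub>total_quotient R\<^esub> y = y \<oplus>\<^bsub>total_quotient R\<^esub> x"
      by (elim total_quotientE) (simp add: total_quotient_add nzd_mult nzd_closed m_ac a_ac)
  next
    fix x assume "x \<in> carrier (total_quotient R)"
    then show "\<zero>\<^bsub>total_quotient R\<^esub> \<oplus>\<^bsub>total_quotient R\<^esub> x = x"
      by (elim total_quotientE) (simp add: total_quotient_zero total_quotient_add nzd_one nzd_closed)
  next
    fix x assume "x \<in> carrier (total_quotient R)"
    then obtain a b where ab: "a \<in> carrier R" "b \<in> nonzerodivisors R" "x = fraction R a b"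
      by (rule total_quotientE)
    have "fraction R (\<ominus> a) b \<oplus>\<^bsub>total_quotient R\<^esub> x = \<zero>\<^bsub>total_quotient R\<^esub>"
      using ab nzd_closed[OF ab(2)]
      by (simp add: total_quotient_zero total_quotient_add nzd_one nzd_mult fraction_eq_iff
          l_minus l_neg)
    then show "\<exists>y\<in>carrier (total_quotient R). y \<oplus>\<^bsub>total_quotient R\<^esub> x = \<zero>\<^bsub>total_quotient R\<^esub>"
      using ab by (intro bexI) auto
  qed
next
  fix r x assume "r \<in> carrier R" "x \<in> carrier (total_quotient R)"
  then show "r \<odot>\<^bsub>total_quotient R\<^esub> x \<in> carrier (total_quotient R)"
    by (elim total_quotientE) (simp add: total_quotient_smult fraction_closed)
next
  fix r s x assume "r \<in> carrier R" "s \<in> carrier R" "x \<in> carrier (total_quotient R)"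
  \<comment> \<open>For x = a/b the sum on the right has denominator \<open>b \<otimes> b\<close>
    while the left side has \<open>b\<close>, so the two classes are compared by
    cross-multiplication.\<close>
  then show "(r \<oplus> s) \<odot>\<^bsub>total_quotient R\<^esub> x
      = r \<odot>\<^bsub>total_quotient R\<^esub> x \<oplus>\<^bsub>total_quotient R\<^esub> s \<odot>\<^bsub>total_quotient R\<^esub> x"
    by (elim total_quotientE)
      (simp add: total_quotient_smult total_quotient_add nzd_closed nzd_mult fraction_eq_iff
        l_distr r_distr m_ac)
next
  fix r x y assume "r \<in> carrier R" "x \<in> carrier (total_quotient R)" "y \<in> carrier (total_quotient R)"
  then show "r \<odot>\<^bsub>total_quotient R\<^esub> (x \<oplus>\<^bsub>total_quotient R\<^esub> y)
      = r \<odot>\<^bsub>total_quotient R\<^esub> x \<oplus>\<^bsub>total_quotient R\<^esub> r \<odot>\<^bsub>total_quotient R\<^esub> y"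
    by (elim total_quotientE)
      (simp add: total_quotient_smult total_quotient_add nzd_closed nzd_mult r_distr m_ac)
next
  fix r s x assume "r \<in> carrier R" "s \<in> carrier R" "x \<in> carrier (total_quotient R)"
  then show "r \<otimes> s \<odot>\<^bsub>total_quotient R\<^esub> x
      = r \<odot>\<^bsub>total_quotient R\<^esub> (s \<odot>\<^bsub>total_quotient R\<^esub> x)"
    by (elim total_quotientE) (simp add: total_quotient_smult m_assoc)
next
  fix x assume "x \<in> carrier (total_quotient R)"
  then show "\<one> \<odot>\<^bsub>total_quotient R\<^esub> x = x"
    by (elim total_quotientE) (simp add: total_quotient_smult)
qed (rule is_cring)

section \<open>Positive grade\<close>

lemma genideal_empty: "Idl {} = {\<zero>}"
proof
  show "Idl {} \<subseteq> {\<zero>}" by (rule genideal_minimal[OF zeroideal]) simp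
  show "{\<zero>} \<subseteq> Idl {}"
    using additive_subgroup.zero_closed[OF ideal.axioms(1)[OF genideal_ideal]] by blast
qed

text \<open>Cosets of the zero ideal are singletons, so the quotient is a copy of R. This is the
  quotient in which the first entry of a regular sequence is tested, since \<open>Idl {}\<close> is
  the zero ideal.\<close>

lemma nzd_of_quot_zero:
  assumes y: "y \<in> carrier R" and nzd: "{\<zero>} +> y \<in> nonzerodivisors (R Quot {\<zero>})"
  shows "y \<in> nonzerodivisors R"
proof -
  interpret Z: ideal "{\<zero>}" R by (rule zeroideal)
  have coset: "{\<zero>} +> r = {r}" if "r \<in> carrier R" for r
    using that by (simp add: a_r_coset_def')
  have "x = \<zero>" if x: "x \<in> carrier R" and "y \<otimes> x = \<zero>" for x
  proof -
    have "{\<zero>} +> x \<in> carrier (R Quot {\<zero>})"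
      using x by (auto simp: FactRing_simps)
    moreover have "({\<zero>} +> y) \<otimes>\<^bsub>R Quot {\<zero>}\<^esub> ({\<zero>} +> x) = \<zero>\<^bsub>R Quot {\<zero>}\<^esub>"
      unfolding FactRing_def monoid.simps ring.simps Z.rcoset_mult_add[OF y x] that(2)
      by (rule coset[OF zero_closed])
    ultimately have "{\<zero>} +> x = \<zero>\<^bsub>R Quot {\<zero>}\<^esub>"
      using nzd unfolding nonzerodivisors_def by blast
    then have "{x} = {\<zero>}" by (simp only: coset[OF x]) (simp add: FactRing_def)
    then show ?thesis by simp
  qed
  then show ?thesis using y unfolding nonzerodivisors_def by blast
qed

lemma regular_sequence_hd_nzd:
  assumes "regular_sequence R (y # ys)"
  shows "y \<in> nonzerodivisors R"
proof (rule nzd_of_quot_zero)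
  show "y \<in> carrier R" using assms by (simp add: regular_sequence_def)
  show "{\<zero>} +> y \<in> nonzerodivisors (R Quot {\<zero>})"
    using assms unfolding regular_sequence_def Let_def genideal_empty[symmetric]
    by (metis length_greater_0_conv list.distinct(1) list.set(1) nth_Cons_0 take0)
qed

text \<open>A nonempty regular sequence starts with a nonzerodivisor. If a proper ideal contains
  none, the empty sequence is therefore the only regular sequence inside it, and the grade evaluates
  to 0.\<close>

lemma grade_pos_imp_nzd:
  assumes I: "ideal I R" and pos: "0 < grade R I"
  shows "\<exists>x\<in>I. x \<in> nonzerodivisors R"
proof (cases "I = carrier R")
  case True
  then show ?thesis using nzd_one by blast
next
  case False
  show ?thesis
  proof (rule ccontr)
    assume no: "\<not> ?thesis"
    have zero: "\<zero> \<in> I"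
      using additive_subgroup.zero_closed[OF ideal.axioms(1)[OF I]] .
    \<comment> \<open>The empty sequence counts as regular only if the ideal it generates is proper.
      A zero ring would force I to be the whole ring.\<close>
    have "{\<zero>} \<noteq> carrier R"
      using False zero ideal.Icarr[OF I] by (metis singleton_iff subsetI subset_antisym singletonD)
    then have "regular_sequence R []"
      by (simp add: regular_sequence_def genideal_empty)
    then have nil: "maximal_regular_sequence_in R I []"
      using no regular_sequence_hd_nzd by (auto simp: maximal_regular_sequence_in_def)
    \<comment> \<open>Uniqueness of the maximal sequence is what lets the definite description in
      \<open>grade\<close> be evaluated as 0.\<close>
    have "xs = []" if "maximal_regular_sequence_in R I xs" for xs
      using that no regular_sequence_hd_nzd
      by (cases xs) (auto simp: maximal_regular_sequence_in_def)
    then have "(THE n. \<exists>xs. maximal_regular_sequence_in R I xs \<and> length xs = n) = 0"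
      using nil by (intro the_equality) auto
    then show False
      using pos False by (simp add: grade_def zero_enat_def)
  qed
qed

end

section \<open>Modules of homomorphisms\<close>

lemma module_homI:
  assumes "f \<in> carrier M \<rightarrow>\<^sub>E carrier N"
    and "\<And>x y. x \<in> carrier M \<Longrightarrow> y \<in> carrier M \<Longrightarrow> f (x \<oplus>\<^bsub>M\<^esub> y) = f x \<oplus>\<^bsub>N\<^esub> f y"
    and "\<And>r x. r \<in> carrier R \<Longrightarrow> x \<in> carrier M \<Longrightarrow> f (r \<odot>\<^bsub>M\<^esub> x) = r \<odot>\<^bsub>N\<^esub> f x"
  shows "f \<in> module_hom R M N"
  using assms by (simp add: module_hom_def)

lemma module_homD:
  assumes "f \<in> module_hom R M N"
  shows "x \<in> carrier M \<Longrightarrow> f x \<in> carrier N"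
    and "x \<in> carrier M \<Longrightarrow> y \<in> carrier M \<Longrightarrow> f (x \<oplus>\<^bsub>M\<^esub> y) = f x \<oplus>\<^bsub>N\<^esub> f y"
    and "r \<in> carrier R \<Longrightarrow> x \<in> carrier M \<Longrightarrow> f (r \<odot>\<^bsub>M\<^esub> x) = r \<odot>\<^bsub>N\<^esub> f x"
  using assms by (auto simp: module_hom_def)

lemma module_hom_eqI:
  assumes "f \<in> module_hom R M N" "g \<in> module_hom R M N"
    and "\<And>x. x \<in> carrier M \<Longrightarrow> f x = g x"
  shows "f = g"
proof (rule PiE_ext)
  show "f \<in> carrier M \<rightarrow>\<^sub>E carrier N" "g \<in> carrier M \<rightarrow>\<^sub>E carrier N"
    using assms(1,2) by (simp_all add: module_hom_def)
qed (rule assms(3))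

lemma Hom_module_simps [simp]:
  "carrier (Hom_module R M N) = module_hom R M N"
  "\<zero>\<^bsub>Hom_module R M N\<^esub> = (\<lambda>x\<in>carrier M. \<zero>\<^bsub>N\<^esub>)"
  "f \<oplus>\<^bsub>Hom_module R M N\<^esub> g = (\<lambda>x\<in>carrier M. f x \<oplus>\<^bsub>N\<^esub> g x)"
  "r \<odot>\<^bsub>Hom_module R M N\<^esub> f = (\<lambda>x\<in>carrier M. r \<odot>\<^bsub>N\<^esub> f x)"
  by (simp_all add: Hom_module_def)

lemma ideal_module_simps [simp]:
  "carrier (ideal_module R I) = I"
  "\<zero>\<^bsub>ideal_module R I\<^esub> = \<zero>\<^bsub>R\<^esub>"
  "x \<oplus>\<^bsub>ideal_module R I\<^esub> y = x \<oplus>\<^bsub>R\<^esub> y"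
  "r \<odot>\<^bsub>ideal_module R I\<^esub> x = r \<otimes>\<^bsub>R\<^esub> x"
  by (simp_all add: ideal_module_def)

lemma End_algebra_simps [simp]:
  "carrier (End_algebra R N) = module_hom R N N"
  "zero (End_algebra R N) = zero (Hom_module R N N)"
  "add (End_algebra R N) = add (Hom_module R N N)"
  "smult (End_algebra R N) = smult (Hom_module R N N)"
  "g \<otimes>\<^bsub>End_algebra R N\<^esub> f = compose (carrier N) g f"
  by (simp_all add: End_algebra_def Hom_module_def)

lemma center_End_simps [simp]:
  "zero (center_End R N) = zero (Hom_module R N N)"
  "add (center_End R N) = add (Hom_module R N N)"
  "smult (center_End R N) = smult (Hom_module R N N)"
  by (simp_all add: center_End_def)

text \<open>\<open>compose\<close> is extensional on the carrier, so commuting in the endomorphism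
  algebra amounts to commuting pointwise on N.\<close>

lemma mem_center_End_iff:
  "z \<in> carrier (center_End R N) \<longleftrightarrow>
    z \<in> module_hom R N N \<and>
    (\<forall>s\<in>module_hom R N N. \<forall>x\<in>carrier N. z (s x) = s (z x))"
proof -
  have "compose (carrier N) z s = compose (carrier N) s z \<longleftrightarrow> (\<forall>x\<in>carrier N. z (s x) = s (z x))" for s
    by (auto simp: compose_def fun_eq_iff)
  then show ?thesis
    by (simp add: center_End_def ring_center_def)
qed

context cring
begin

lemma module_ideal_module:
  assumes "ideal I R"
  shows "module R (ideal_module R I)"
proof -
  interpret I: ideal I R by fact
  note [simp] = I.Icarr I.a_closed I.zero_closed I.I_l_closed
  show ?thesis
  proof (intro moduleI abelian_groupI)
    fix x assume "x \<in> carrier (ideal_module R I)"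
    then show "\<exists>y\<in>carrier (ideal_module R I). y \<oplus>\<^bsub>ideal_module R I\<^esub> x = \<zero>\<^bsub>ideal_module R I\<^esub>"
      by (auto intro!: bexI[of _ "\<ominus> x"] simp: l_neg I.a_inv_closed)
  qed (auto simp: is_cring l_distr r_distr m_assoc a_ac)
qed

lemma Hom_module_closed:
  assumes "module R M" "module R N"
  shows "\<zero>\<^bsub>Hom_module R M N\<^esub> \<in> module_hom R M N"
    and "f \<in> module_hom R M N \<Longrightarrow> g \<in> module_hom R M N \<Longrightarrow>
      f \<oplus>\<^bsub>Hom_module R M N\<^esub> g \<in> module_hom R M N"
    and "r \<in> carrier R \<Longrightarrow> f \<in> module_hom R M N \<Longrightarrow>
      r \<odot>\<^bsub>Hom_module R M N\<^esub> f \<in> module_hom R M N"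
proof -
  interpret M: module R M by fact
  interpret N: module R N by fact
  show "\<zero>\<^bsub>Hom_module R M N\<^esub> \<in> module_hom R M N"
    by (auto intro!: module_homI)
  show "f \<oplus>\<^bsub>Hom_module R M N\<^esub> g \<in> module_hom R M N"
    if f: "f \<in> module_hom R M N" and g: "g \<in> module_hom R M N"
    by (rule module_homI)
      (use module_homD[OF f] module_homD[OF g] in
        \<open>auto simp: N.smult_r_distr N.M.a_ac\<close>)
  show "r \<odot>\<^bsub>Hom_module R M N\<^esub> f \<in> module_hom R M N"
    if r: "r \<in> carrier R" and f: "f \<in> module_hom R M N"
    by (rule module_homI)
      (use module_homD[OF f] r in
        \<open>auto simp: N.smult_r_distr N.smult_assoc1[symmetric] m_comm\<close>)
qed

text \<open>The module axioms are checked pointwise in N once and for all. Given closure of the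
  carrier, this covers the full Hom module, the endomorphism algebra and its center, whose records
  share zero, addition and scalar action.\<close>

lemma module_of_homs:
  assumes M: "module R M" and N: "module R N"
    and sub: "carrier H \<subseteq> module_hom R M N"
    and eqs: "zero H = zero (Hom_module R M N)" "add H = add (Hom_module R M N)"
      "smult H = smult (Hom_module R M N)"
    and zero: "\<zero>\<^bsub>H\<^esub> \<in> carrier H"
    and add: "\<And>f g. f \<in> carrier H \<Longrightarrow> g \<in> carrier H \<Longrightarrow> f \<oplus>\<^bsub>H\<^esub> g \<in> carrier H"
    and smult: "\<And>r f. r \<in> carrier R \<Longrightarrow> f \<in> carrier H \<Longrightarrow> r \<odot>\<^bsub>H\<^esub> f \<in> carrier H"
  shows "module R H"
proof -
  interpret M: module R M by fact
  interpret N: module R N by fact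
  have val: "f x \<in> carrier N" if "f \<in> carrier H" "x \<in> carrier M" for f x
    using subsetD[OF sub that(1)] that(2) by (rule module_homD(1))
  have ext: "f = g" if "f \<in> carrier H" "g \<in> carrier H" "\<And>x. x \<in> carrier M \<Longrightarrow> f x = g x" for f g
    using subsetD[OF sub that(1)] subsetD[OF sub that(2)] that(3) by (rule module_hom_eqI)
  note [simp] = eqs val
  show ?thesis
  proof (intro moduleI abelian_groupI is_cring)
    fix f assume f: "f \<in> carrier H"
    show "\<exists>g\<in>carrier H. g \<oplus>\<^bsub>H\<^esub> f = \<zero>\<^bsub>H\<^esub>"
    proof
      \<comment> \<open>The additive inverse is obtained as -1 times f, so closure under scalars
        keeps it in the carrier.\<close>
      show g: "\<ominus> \<one> \<odot>\<^bsub>H\<^esub> f \<in> carrier H" using f by (intro smult) auto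
      show "\<ominus> \<one> \<odot>\<^bsub>H\<^esub> f \<oplus>\<^bsub>H\<^esub> f = \<zero>\<^bsub>H\<^esub>"
        by (rule ext) (use f g zero add[OF g f] in \<open>auto simp: N.smult_l_minus N.M.l_neg\<close>)
    qed
  next
    fix f g h assume "f \<in> carrier H" "g \<in> carrier H" "h \<in> carrier H"
    then show "f \<oplus>\<^bsub>H\<^esub> g \<oplus>\<^bsub>H\<^esub> h = f \<oplus>\<^bsub>H\<^esub> (g \<oplus>\<^bsub>H\<^esub> h)"
      by (intro ext add) (auto simp: N.M.a_assoc)
  next
    fix f g assume "f \<in> carrier H" "g \<in> carrier H"
    then show "f \<oplus>\<^bsub>H\<^esub> g = g \<oplus>\<^bsub>H\<^esub> f"
      by (intro ext add) (auto simp: N.M.a_comm)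
  next
    fix f assume f: "f \<in> carrier H"
    then show "\<zero>\<^bsub>H\<^esub> \<oplus>\<^bsub>H\<^esub> f = f"
      by (intro ext add zero) auto
    show "\<one> \<odot>\<^bsub>H\<^esub> f = f"
      using f by (intro ext smult) auto
  next
    fix r s f assume "r \<in> carrier R" "s \<in> carrier R" "f \<in> carrier H"
    then show "(r \<oplus> s) \<odot>\<^bsub>H\<^esub> f = r \<odot>\<^bsub>H\<^esub> f \<oplus>\<^bsub>H\<^esub> s \<odot>\<^bsub>H\<^esub> f"
      by (intro ext add smult) (auto simp: N.smult_l_distr)
  next
    fix r f g assume "r \<in> carrier R" "f \<in> carrier H" "g \<in> carrier H"
    then show "r \<odot>\<^bsub>H\<^esub> (f \<oplus>\<^bsub>H\<^esub> g) = r \<odot>\<^bsub>H\<^esub> f \<oplus>\<^bsub>H\<^esub> r \<odot>\<^bsub>H\<^esub> g"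
      by (intro ext add smult) (auto simp: N.smult_r_distr)
  next
    fix r s f assume "r \<in> carrier R" "s \<in> carrier R" "f \<in> carrier H"
    then show "(r \<otimes> s) \<odot>\<^bsub>H\<^esub> f = r \<odot>\<^bsub>H\<^esub> (s \<odot>\<^bsub>H\<^esub> f)"
      by (intro ext smult) (auto simp: N.smult_assoc1)
  qed (use zero add smult in auto)
qed

lemma module_Hom_module:
  assumes "module R M" "module R N"
  shows "module R (Hom_module R M N)"
  using Hom_module_closed[OF assms] by (intro module_of_homs[OF assms]) auto

lemma module_End_algebra:
  assumes "module R N"
  shows "module R (End_algebra R N)"
  using Hom_module_closed[OF assms assms] by (intro module_of_homs[OF assms assms]) auto

lemma module_center_End:
  assumes N: "module R N"
  shows "module R (center_End R N)"
proof (rule module_of_homs[OF N N])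
  interpret N: module R N by (rule N)
  note closed = Hom_module_closed[OF N N]
  show "\<zero>\<^bsub>center_End R N\<^esub> \<in> carrier (center_End R N)"
    unfolding mem_center_End_iff center_End_simps
  proof (intro conjI ballI closed)
    fix s x assume s: "s \<in> module_hom R N N" and x: "x \<in> carrier N"
    \<comment> \<open>Linearity gives s(0) = 0 through 0 = 0 x, which is what commuting with the
      zero map requires.\<close>
    have "s (\<zero> \<odot>\<^bsub>N\<^esub> x) = \<zero> \<odot>\<^bsub>N\<^esub> s x"
      using module_homD(3)[OF s _ x] by simp
    then show "\<zero>\<^bsub>Hom_module R N N\<^esub> (s x) = s (\<zero>\<^bsub>Hom_module R N N\<^esub> x)"
      using x module_homD(1)[OF s x] by simp
  qed
  show "f \<oplus>\<^bsub>center_End R N\<^esub> g \<in> carrier (center_End R N)"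
    if "f \<in> carrier (center_End R N)" "g \<in> carrier (center_End R N)" for f g
    using that closed(2)[of f g] unfolding mem_center_End_iff center_End_simps
    by (auto simp: module_homD)
  show "r \<odot>\<^bsub>center_End R N\<^esub> f \<in> carrier (center_End R N)"
    if "r \<in> carrier R" "f \<in> carrier (center_End R N)" for r f
    using that closed(3)[of r f] unfolding mem_center_End_iff center_End_simps
    by (auto simp: module_homD)
qed (auto simp: mem_center_End_iff)

section \<open>Endomorphisms that are multiplications by fractions\<close>

text \<open>The identified subset is the image of the linear map \<phi> whose graph is P. Zero and
  negatives in the image come from the scalars 0 and -1.\<close>

lemma submodule_identified_subset:
  assumes "is_identification R A P"
  shows "submodule (identified_subset A P) R (total_quotient R)"
proof -
  obtain \<phi> where A: "module R A" and \<phi>: "\<phi> \<in> module_hom R A (total_quotient R)"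
    and P: "\<And>h q. h \<in> carrier A \<Longrightarrow> P h q \<longleftrightarrow> q = \<phi> h"
    using assms by (auto simp: is_identification_def)
  interpret A: module R A by (rule A)
  interpret Q: module R "total_quotient R" by (rule module_total_quotient)
  have img: "identified_subset A P = \<phi> ` carrier A"
    using P by (auto simp: identified_subset_def)
  note hom = module_homD[OF \<phi>]
  have smult: "r \<odot>\<^bsub>total_quotient R\<^esub> q \<in> \<phi> ` carrier A" if "r \<in> carrier R" "q \<in> \<phi> ` carrier A" for r q
    using that by (auto simp: hom(3)[symmetric])
  show ?thesis
    unfolding img
  proof (rule Q.submoduleI)
    show "\<phi> ` carrier A \<subseteq> carrier (total_quotient R)" using hom(1) by blast
    show "\<zero>\<^bsub>total_quotient R\<^esub> \<in> \<phi> ` carrier A"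
      using smult[of \<zero> "\<phi> \<zero>\<^bsub>A\<^esub>"] hom(1) by simp
    show "\<ominus>\<^bsub>total_quotient R\<^esub> q \<in> \<phi> ` carrier A" if "q \<in> \<phi> ` carrier A" for q
      using smult[of "\<ominus> \<one>" q] that hom(1) by (auto simp: Q.smult_l_minus)
    show "p \<oplus>\<^bsub>total_quotient R\<^esub> q \<in> \<phi> ` carrier A" if "p \<in> \<phi> ` carrier A" "q \<in> \<phi> ` carrier A" for p q
      using that by (auto simp: hom(2)[symmetric])
  qed (rule smult)
qed

section \<open>Torsion-free and faithful modules, and uniqueness of fractions\<close>

definition torsion_free :: "('a, 'c, 'n) module_scheme \<Rightarrow> bool" where
  "torsion_free N \<longleftrightarrow> (\<forall>b\<in>nonzerodivisors R. inj_on (\<lambda>v. b \<odot>\<^bsub>N\<^esub> v) (carrier N))"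

text \<open>This is injectivity of the action map from R into the self-maps of N. The restriction to
  the carrier makes equality of functions mean equality of the two actions on N.\<close>

definition faithful :: "('a, 'c, 'n) module_scheme \<Rightarrow> bool" where
  "faithful N \<longleftrightarrow> inj_on (\<lambda>r. \<lambda>v\<in>carrier N. r \<odot>\<^bsub>N\<^esub> v) (carrier R)"

lemma torsion_freeD:
  assumes "torsion_free N" "b \<in> nonzerodivisors R" "v \<in> carrier N" "w \<in> carrier N"
    and "b \<odot>\<^bsub>N\<^esub> v = b \<odot>\<^bsub>N\<^esub> w"
  shows "v = w"
  using assms by (auto simp: torsion_free_def dest: inj_onD)

lemma faithfulD:
  assumes "faithful N" "a \<in> carrier R" "c \<in> carrier R"
    and "\<And>v. v \<in> carrier N \<Longrightarrow> a \<odot>\<^bsub>N\<^esub> v = c \<odot>\<^bsub>N\<^esub> v"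
  shows "a = c"
  using assms(1)[unfolded faithful_def]
proof (rule inj_onD)
  show "(\<lambda>v\<in>carrier N. a \<odot>\<^bsub>N\<^esub> v) = (\<lambda>v\<in>carrier N. c \<odot>\<^bsub>N\<^esub> v)"
    using assms(4) by (rule restrict_ext)
qed (use assms in auto)

lemma is_mult_byE:
  assumes "is_mult_by R N f q"
  obtains a b where "a \<in> carrier R" "b \<in> nonzerodivisors R" "q = fraction R a b"
    "\<And>v. v \<in> carrier N \<Longrightarrow> b \<odot>\<^bsub>N\<^esub> f v = a \<odot>\<^bsub>N\<^esub> v"
  using assms by (auto simp: is_mult_by_def)

text \<open>The inclusion of aN in bN demanded by \<open>is_mult_by\<close> is automatic: f provides
  the quotient of \<open>a v\<close> by b.\<close>

lemma is_mult_byI: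
  assumes "a \<in> carrier R" "b \<in> nonzerodivisors R" "f \<in> carrier N \<rightarrow> carrier N"
    and "\<And>v. v \<in> carrier N \<Longrightarrow> b \<odot>\<^bsub>N\<^esub> f v = a \<odot>\<^bsub>N\<^esub> v"
  shows "is_mult_by R N f (fraction R a b)"
  unfolding is_mult_by_def using assms
  by (intro bexI[of _ a] bexI[of _ b] conjI refl ballI) (auto simp: assms(4)[symmetric])

text \<open>If f is multiplication by a/b and by c/d, then ad and cb both act on N as bd f.
  Faithfulness turns this into ad = cb, which is equality of the fractions.\<close>

lemma is_mult_by_unique:
  assumes N: "module R N" and "faithful N" and f: "f \<in> carrier N \<rightarrow> carrier N"
    and p: "is_mult_by R N f p" and q: "is_mult_by R N f q"
  shows "p = q"
proof -
  interpret N: module R N by (rule N)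
  obtain a b where ab: "a \<in> carrier R" "b \<in> nonzerodivisors R" "p = fraction R a b"
    "\<And>v. v \<in> carrier N \<Longrightarrow> b \<odot>\<^bsub>N\<^esub> f v = a \<odot>\<^bsub>N\<^esub> v"
    by (rule is_mult_byE[OF p]) (rule that)
  obtain c d where cd: "c \<in> carrier R" "d \<in> nonzerodivisors R" "q = fraction R c d"
    "\<And>v. v \<in> carrier N \<Longrightarrow> d \<odot>\<^bsub>N\<^esub> f v = c \<odot>\<^bsub>N\<^esub> v"
    by (rule is_mult_byE[OF q]) (rule that)
  have bd: "b \<in> carrier R" "d \<in> carrier R" using ab cd by (auto intro: nzd_closed)
  have "a \<otimes> d = c \<otimes> b"
  proof (rule faithfulD[OF assms(2)])
    fix v assume v: "v \<in> carrier N"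
    then have fv: "f v \<in> carrier N" using f by auto
    have "(a \<otimes> d) \<odot>\<^bsub>N\<^esub> v = d \<odot>\<^bsub>N\<^esub> (a \<odot>\<^bsub>N\<^esub> v)"
      using ab cd bd v by (simp add: m_comm flip: N.smult_assoc1)
    also have "\<dots> = d \<odot>\<^bsub>N\<^esub> (b \<odot>\<^bsub>N\<^esub> f v)" using ab v by simp
    also have "\<dots> = b \<odot>\<^bsub>N\<^esub> (d \<odot>\<^bsub>N\<^esub> f v)"
      using bd fv by (simp add: m_comm flip: N.smult_assoc1)
    also have "\<dots> = b \<odot>\<^bsub>N\<^esub> (c \<odot>\<^bsub>N\<^esub> v)" using cd v by simp
    also have "\<dots> = (c \<otimes> b) \<odot>\<^bsub>N\<^esub> v"
      using ab cd bd v by (simp add: m_comm flip: N.smult_assoc1)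
    finally show "(a \<otimes> d) \<odot>\<^bsub>N\<^esub> v = (c \<otimes> b) \<odot>\<^bsub>N\<^esub> v" .
  qed (use ab cd bd in auto)
  then show ?thesis using ab cd by (simp add: fraction_eq_iff)
qed

text \<open>The two representations a/b and c/d of q satisfy ad = cb, so f and g agree after
  multiplication by bd. As bd is a nonzerodivisor, torsion-freeness cancels it.\<close>

lemma is_mult_by_inject:
  assumes N: "module R N" and tf: "torsion_free N"
    and f: "f \<in> module_hom R N N" and g: "g \<in> module_hom R N N"
    and "is_mult_by R N f q" "is_mult_by R N g q"
  shows "f = g"
proof (rule module_hom_eqI[OF f g])
  interpret N: module R N by (rule N)
  obtain a b where ab: "a \<in> carrier R" "b \<in> nonzerodivisors R" "q = fraction R a b"
    "\<And>v. v \<in> carrier N \<Longrightarrow> b \<odot>\<^bsub>N\<^esub> f v = a \<odot>\<^bsub>N\<^esub> v"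
    by (rule is_mult_byE[OF assms(5)]) (rule that)
  obtain c d where cd: "c \<in> carrier R" "d \<in> nonzerodivisors R" "q = fraction R c d"
    "\<And>v. v \<in> carrier N \<Longrightarrow> d \<odot>\<^bsub>N\<^esub> g v = c \<odot>\<^bsub>N\<^esub> v"
    by (rule is_mult_byE[OF assms(6)]) (rule that)
  have bd: "b \<in> carrier R" "d \<in> carrier R" using ab cd by (auto intro: nzd_closed)
  have eq: "a \<otimes> d = c \<otimes> b" using ab cd by (simp add: fraction_eq_iff)
  fix v assume v: "v \<in> carrier N"
  note fg = module_homD(1)[OF f v] module_homD(1)[OF g v]
  show "f v = g v"
  proof (rule torsion_freeD[OF tf nzd_mult[OF ab(2) cd(2)] fg])
    have "(b \<otimes> d) \<odot>\<^bsub>N\<^esub> f v = d \<odot>\<^bsub>N\<^esub> (b \<odot>\<^bsub>N\<^esub> f v)"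
      using bd fg by (simp add: m_comm flip: N.smult_assoc1)
    also have "\<dots> = (a \<otimes> d) \<odot>\<^bsub>N\<^esub> v"
      using ab bd v by (simp add: m_comm flip: N.smult_assoc1)
    also have "\<dots> = b \<odot>\<^bsub>N\<^esub> (d \<odot>\<^bsub>N\<^esub> g v)"
      using cd bd v by (simp add: eq m_comm flip: N.smult_assoc1)
    also have "\<dots> = (b \<otimes> d) \<odot>\<^bsub>N\<^esub> g v"
      using bd fg by (simp flip: N.smult_assoc1)
    finally show "(b \<otimes> d) \<odot>\<^bsub>N\<^esub> f v = (b \<otimes> d) \<odot>\<^bsub>N\<^esub> g v" .
  qed
qed

lemma is_mult_by_add:
  assumes N: "module R N" and f: "f \<in> module_hom R N N" and g: "g \<in> module_hom R N N"
    and "is_mult_by R N f p" "is_mult_by R N g q"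
  shows "is_mult_by R N (f \<oplus>\<^bsub>Hom_module R N N\<^esub> g) (p \<oplus>\<^bsub>total_quotient R\<^esub> q)"
proof -
  interpret N: module R N by (rule N)
  obtain a b where ab: "a \<in> carrier R" "b \<in> nonzerodivisors R" "p = fraction R a b"
    "\<And>v. v \<in> carrier N \<Longrightarrow> b \<odot>\<^bsub>N\<^esub> f v = a \<odot>\<^bsub>N\<^esub> v"
    by (rule is_mult_byE[OF assms(4)]) (rule that)
  obtain c d where cd: "c \<in> carrier R" "d \<in> nonzerodivisors R" "q = fraction R c d"
    "\<And>v. v \<in> carrier N \<Longrightarrow> d \<odot>\<^bsub>N\<^esub> g v = c \<odot>\<^bsub>N\<^esub> v"
    by (rule is_mult_byE[OF assms(5)]) (rule that)
  have bd: "b \<in> carrier R" "d \<in> carrier R" using ab cd by (auto intro: nzd_closed)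
  have "is_mult_by R N (f \<oplus>\<^bsub>Hom_module R N N\<^esub> g) (fraction R (a \<otimes> d \<oplus> c \<otimes> b) (b \<otimes> d))"
  proof (rule is_mult_byI)
    fix v assume v: "v \<in> carrier N"
    note fg = module_homD(1)[OF f v] module_homD(1)[OF g v]
    have "(b \<otimes> d) \<odot>\<^bsub>N\<^esub> (f v \<oplus>\<^bsub>N\<^esub> g v)
        = d \<odot>\<^bsub>N\<^esub> (b \<odot>\<^bsub>N\<^esub> f v) \<oplus>\<^bsub>N\<^esub> b \<odot>\<^bsub>N\<^esub> (d \<odot>\<^bsub>N\<^esub> g v)"
      using bd fg by (simp add: N.smult_r_distr m_comm flip: N.smult_assoc1)
    also have "\<dots> = (a \<otimes> d \<oplus> c \<otimes> b) \<odot>\<^bsub>N\<^esub> v"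
      using ab cd bd v by (simp add: N.smult_l_distr m_comm flip: N.smult_assoc1)
    finally show "(b \<otimes> d) \<odot>\<^bsub>N\<^esub> (f \<oplus>\<^bsub>Hom_module R N N\<^esub> g) v = (a \<otimes> d \<oplus> c \<otimes> b) \<odot>\<^bsub>N\<^esub> v"
      using v by simp
  qed (use ab cd bd nzd_mult module_homD(1)[OF f] module_homD(1)[OF g] in auto)
  then show ?thesis using ab cd by (simp add: total_quotient_add)
qed

lemma is_mult_by_smult:
  assumes N: "module R N" and r: "r \<in> carrier R" and f: "f \<in> module_hom R N N"
    and "is_mult_by R N f q"
  shows "is_mult_by R N (r \<odot>\<^bsub>Hom_module R N N\<^esub> f) (r \<odot>\<^bsub>total_quotient R\<^esub> q)"
proof -
  interpret N: module R N by (rule N)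
  obtain a b where ab: "a \<in> carrier R" "b \<in> nonzerodivisors R" "q = fraction R a b"
    "\<And>v. v \<in> carrier N \<Longrightarrow> b \<odot>\<^bsub>N\<^esub> f v = a \<odot>\<^bsub>N\<^esub> v"
    by (rule is_mult_byE[OF assms(4)]) (rule that)
  have b: "b \<in> carrier R" using ab by (auto intro: nzd_closed)
  have "is_mult_by R N (r \<odot>\<^bsub>Hom_module R N N\<^esub> f) (fraction R (r \<otimes> a) b)"
  proof (rule is_mult_byI)
    fix v assume v: "v \<in> carrier N"
    have "b \<odot>\<^bsub>N\<^esub> (r \<odot>\<^bsub>N\<^esub> f v) = r \<odot>\<^bsub>N\<^esub> (b \<odot>\<^bsub>N\<^esub> f v)"
      using b r module_homD(1)[OF f v] by (simp add: m_comm flip: N.smult_assoc1)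
    then show "b \<odot>\<^bsub>N\<^esub> (r \<odot>\<^bsub>Hom_module R N N\<^esub> f) v = (r \<otimes> a) \<odot>\<^bsub>N\<^esub> v"
      using v ab r by (simp add: N.smult_assoc1)
  qed (use ab r module_homD(1)[OF f] in auto)
  then show ?thesis using ab r by (simp add: total_quotient_smult)
qed

text \<open>Faithfulness makes the fraction of an endomorphism unique and torsion-freeness makes the
  assignment injective. Leaving P general allows the relation \<open>End_ideal_frac\<close> for
  ideals as well as \<open>is_mult_by\<close> itself.\<close>

lemma is_identification_mult_by:
  assumes N: "module R N" and tf: "torsion_free N" and faithful: "faithful N"
    and A: "module R A" "carrier A \<subseteq> module_hom R N N"
      "add A = add (Hom_module R N N)" "smult A = smult (Hom_module R N N)"
    and ex: "\<And>f. f \<in> carrier A \<Longrightarrow> \<exists>q. is_mult_by R N f q"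
    and P: "\<And>f q. f \<in> carrier A \<Longrightarrow> P f q \<longleftrightarrow> is_mult_by R N f q"
  shows "is_identification R A P"
  unfolding is_identification_def
proof (intro conjI bexI ballI allI)
  interpret A: module R A by (rule A)
  have maps: "f \<in> carrier N \<rightarrow> carrier N" "f \<in> module_hom R N N" if "f \<in> carrier A" for f
    using subsetD[OF A(2) that] by (auto dest: module_homD(1))
  define \<phi> where "\<phi> = (\<lambda>f\<in>carrier A. SOME q. is_mult_by R N f q)"
  have \<phi>: "is_mult_by R N f (\<phi> f)" if "f \<in> carrier A" for f
    using ex[OF that] that by (auto simp: \<phi>_def intro: someI_ex)
  have eq: "q = \<phi> f" if "is_mult_by R N f q" "f \<in> carrier A" for f q
    using is_mult_by_unique[OF N faithful maps(1) that(1) \<phi>] that by blast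
  show "P f q \<longleftrightarrow> q = \<phi> f" if "f \<in> carrier A" for f q
    using that P eq \<phi> by blast
  show "inj_on \<phi> (carrier A)"
  proof (rule inj_onI)
    fix f g assume "f \<in> carrier A" "g \<in> carrier A" "\<phi> f = \<phi> g"
    then show "f = g"
      using is_mult_by_inject[OF N tf maps(2) maps(2) \<phi>[of f]] \<phi>[of g] by simp
  qed
  show "\<phi> \<in> module_hom R A (total_quotient R)"
  proof (rule module_homI)
    show "\<phi> \<in> carrier A \<rightarrow>\<^sub>E carrier (total_quotient R)"
    proof (rule PiE_I)
      fix f assume "f \<in> carrier A"
      then show "\<phi> f \<in> carrier (total_quotient R)"
        using is_mult_byE[OF \<phi>] fraction_closed by metis
    qed (simp add: \<phi>_def)
  next
    fix f g assume fg: "f \<in> carrier A" "g \<in> carrier A"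
    \<comment> \<open>The sum of the two chosen fractions also describes the sum of the maps, so
      uniqueness forces additivity of \<phi> although its values were chosen arbitrarily. Scalars
      are treated in the same way.\<close>
    then have "is_mult_by R N (f \<oplus>\<^bsub>A\<^esub> g) (\<phi> f \<oplus>\<^bsub>total_quotient R\<^esub> \<phi> g)"
      unfolding A(3) by (intro is_mult_by_add N maps(2) \<phi>)
    then show "\<phi> (f \<oplus>\<^bsub>A\<^esub> g) = \<phi> f \<oplus>\<^bsub>total_quotient R\<^esub> \<phi> g"
      using fg by (intro eq[symmetric] A.M.a_closed)
  next
    fix r f assume rf: "r \<in> carrier R" "f \<in> carrier A"
    then have "is_mult_by R N (r \<odot>\<^bsub>A\<^esub> f) (r \<odot>\<^bsub>total_quotient R\<^esub> \<phi> f)"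
      unfolding A(4) by (intro is_mult_by_smult N maps(2) \<phi>)
    then show "\<phi> (r \<odot>\<^bsub>A\<^esub> f) = r \<odot>\<^bsub>total_quotient R\<^esub> \<phi> f"
      using rf by (intro eq[symmetric] A.smult_closed)
  qed
qed (rule A module_total_quotient)+

text \<open>The pointwise quotient of a \<alpha> by b is unique by torsion-freeness, hence linear.
  With \<alpha> the identity of N it constructs multiplication by a/b; with N = R it divides
  functionals.\<close>

lemma quotient_hom:
  assumes M: "module R M" and N: "module R N" and tf: "torsion_free N"
    and a: "a \<in> carrier R" and b: "b \<in> nonzerodivisors R"
    and \<alpha>: "\<alpha> \<in> module_hom R M N"
    and div: "\<And>m. m \<in> carrier M \<Longrightarrow> \<exists>z\<in>carrier N. a \<odot>\<^bsub>N\<^esub> \<alpha> m = b \<odot>\<^bsub>N\<^esub> z"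
  shows "\<exists>\<beta>\<in>module_hom R M N. \<forall>m\<in>carrier M. b \<odot>\<^bsub>N\<^esub> \<beta> m = a \<odot>\<^bsub>N\<^esub> \<alpha> m"
proof -
  interpret M: module R M by (rule M)
  interpret N: module R N by (rule N)
  define \<beta> where "\<beta> = (\<lambda>m\<in>carrier M. SOME z. z \<in> carrier N \<and> a \<odot>\<^bsub>N\<^esub> \<alpha> m = b \<odot>\<^bsub>N\<^esub> z)"
  have "\<beta> m \<in> carrier N \<and> a \<odot>\<^bsub>N\<^esub> \<alpha> m = b \<odot>\<^bsub>N\<^esub> \<beta> m" if "m \<in> carrier M" for m
  proof -
    have "\<exists>z. z \<in> carrier N \<and> a \<odot>\<^bsub>N\<^esub> \<alpha> m = b \<odot>\<^bsub>N\<^esub> z" using div[OF that] by blast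
    from someI_ex[OF this] show ?thesis using that by (simp add: \<beta>_def)
  qed
  then have \<beta>: "\<beta> m \<in> carrier N" "b \<odot>\<^bsub>N\<^esub> \<beta> m = a \<odot>\<^bsub>N\<^esub> \<alpha> m" if "m \<in> carrier M" for m
    using that by auto
  note bR = nzd_closed[OF b]
  note \<alpha>D = module_homD[OF \<alpha>]
  have "\<beta> \<in> module_hom R M N"
  proof (rule module_homI)
    show "\<beta> \<in> carrier M \<rightarrow>\<^sub>E carrier N"
      using \<beta>(1) by (auto simp: \<beta>_def)
  next
    fix x y assume xy: "x \<in> carrier M" "y \<in> carrier M"
    show "\<beta> (x \<oplus>\<^bsub>M\<^esub> y) = \<beta> x \<oplus>\<^bsub>N\<^esub> \<beta> y"
      by (rule torsion_freeD[OF tf b])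
        (use xy \<beta> \<alpha>D a bR in \<open>simp_all add: N.smult_r_distr\<close>)
  next
    fix r x assume r: "r \<in> carrier R" and x: "x \<in> carrier M"
    show "\<beta> (r \<odot>\<^bsub>M\<^esub> x) = r \<odot>\<^bsub>N\<^esub> \<beta> x"
    proof (rule torsion_freeD[OF tf b])
      have "b \<odot>\<^bsub>N\<^esub> (r \<odot>\<^bsub>N\<^esub> \<beta> x) = r \<odot>\<^bsub>N\<^esub> (b \<odot>\<^bsub>N\<^esub> \<beta> x)"
        using r bR \<beta>(1)[OF x] by (simp add: m_comm flip: N.smult_assoc1)
      also have "\<dots> = a \<odot>\<^bsub>N\<^esub> (r \<odot>\<^bsub>N\<^esub> \<alpha> x)"
        using r a \<alpha>D(1)[OF x] by (simp add: \<beta>(2)[OF x] m_comm flip: N.smult_assoc1)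
      also have "\<dots> = b \<odot>\<^bsub>N\<^esub> \<beta> (r \<odot>\<^bsub>M\<^esub> x)"
        using r x by (simp add: \<beta>(2) \<alpha>D(3))
      finally show "b \<odot>\<^bsub>N\<^esub> \<beta> (r \<odot>\<^bsub>M\<^esub> x) = b \<odot>\<^bsub>N\<^esub> (r \<odot>\<^bsub>N\<^esub> \<beta> x)" ..
    qed (use r x \<beta>(1) in auto)
  qed
  then show ?thesis using \<beta>(2) by blast
qed

text \<open>These are the fractions having some representative a/b with aN inside bN. The condition
  makes sense for modules not embedded in Q(R), such as the dual, so ideals and the dual can be
  compared through it.\<close>

definition multipliers :: "('a, 'c, 'n) module_scheme \<Rightarrow> ('a \<times> 'a) set set" where
  "multipliers N = {fraction R a b | a b. a \<in> carrier R \<and> b \<in> nonzerodivisors R \<and>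
    (\<forall>v\<in>carrier N. \<exists>w\<in>carrier N. a \<odot>\<^bsub>N\<^esub> v = b \<odot>\<^bsub>N\<^esub> w)}"

lemma multipliersE:
  assumes "q \<in> multipliers N"
  obtains a b where "a \<in> carrier R" "b \<in> nonzerodivisors R" "q = fraction R a b"
    "\<And>v. v \<in> carrier N \<Longrightarrow> \<exists>w\<in>carrier N. a \<odot>\<^bsub>N\<^esub> v = b \<odot>\<^bsub>N\<^esub> w"
  using assms by (auto simp: multipliers_def)

lemma multipliersI:
  assumes "a \<in> carrier R" "b \<in> nonzerodivisors R"
    "\<And>v. v \<in> carrier N \<Longrightarrow> \<exists>w\<in>carrier N. a \<odot>\<^bsub>N\<^esub> v = b \<odot>\<^bsub>N\<^esub> w"
  shows "fraction R a b \<in> multipliers N"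
  using assms unfolding multipliers_def by blast

lemma is_mult_by_imp_multipliers:
  assumes "f \<in> module_hom R N N" "is_mult_by R N f q"
  shows "q \<in> multipliers N"
proof -
  obtain a b where ab: "a \<in> carrier R" "b \<in> nonzerodivisors R" "q = fraction R a b"
    "\<And>v. v \<in> carrier N \<Longrightarrow> b \<odot>\<^bsub>N\<^esub> f v = a \<odot>\<^bsub>N\<^esub> v"
    by (rule is_mult_byE[OF assms(2)]) (rule that)
  show ?thesis
    unfolding ab(3)
  proof (rule multipliersI[OF ab(1,2)])
    show "\<exists>w\<in>carrier N. a \<odot>\<^bsub>N\<^esub> v = b \<odot>\<^bsub>N\<^esub> w" if "v \<in> carrier N" for v
      using module_homD(1)[OF assms(1) that] ab(4)[OF that] by metis
  qed
qed

text \<open>Multiplication by \<open>a / b\<close> commutes with every endomorphism, hence is central.\<close>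

lemma multipliers_imp_center:
  assumes N: "module R N" and tf: "torsion_free N" and q: "q \<in> multipliers N"
  shows "\<exists>f\<in>carrier (center_End R N). is_mult_by R N f q"
proof -
  interpret N: module R N by (rule N)
  obtain a b where ab: "a \<in> carrier R" "b \<in> nonzerodivisors R" "q = fraction R a b"
    "\<And>v. v \<in> carrier N \<Longrightarrow> \<exists>w\<in>carrier N. a \<odot>\<^bsub>N\<^esub> v = b \<odot>\<^bsub>N\<^esub> w"
    by (rule multipliersE[OF q]) (rule that)
  have id: "(\<lambda>v\<in>carrier N. v) \<in> module_hom R N N"
    by (rule module_homI) auto
  \<comment> \<open>Dividing a times the identity map by b yields the endomorphism that acts as
    a/b.\<close>
  have "\<exists>f\<in>module_hom R N N. \<forall>v\<in>carrier N. b \<odot>\<^bsub>N\<^esub> f v = a \<odot>\<^bsub>N\<^esub> (\<lambda>v\<in>carrier N. v) v"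
    by (rule quotient_hom[OF N N tf ab(1,2) id]) (use ab(4) in simp)
  then obtain f where f: "f \<in> module_hom R N N"
    and fv: "\<And>v. v \<in> carrier N \<Longrightarrow> b \<odot>\<^bsub>N\<^esub> f v = a \<odot>\<^bsub>N\<^esub> v"
    by auto
  have "f (s v) = s (f v)" if s: "s \<in> module_hom R N N" and v: "v \<in> carrier N" for s v
  proof (rule torsion_freeD[OF tf ab(2)])
    note sD = module_homD[OF s]
    have "b \<odot>\<^bsub>N\<^esub> f (s v) = s (a \<odot>\<^bsub>N\<^esub> v)"
      using v ab(1) by (simp add: fv sD)
    also have "\<dots> = b \<odot>\<^bsub>N\<^esub> s (f v)"
      using v nzd_closed[OF ab(2)] by (simp add: sD(3) module_homD(1)[OF f] flip: fv)
    finally show "b \<odot>\<^bsub>N\<^esub> f (s v) = b \<odot>\<^bsub>N\<^esub> s (f v)" .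
  qed (use module_homD(1)[OF s] module_homD(1)[OF f] v in auto)
  then have "f \<in> carrier (center_End R N)"
    using f by (simp add: mem_center_End_iff)
  moreover have "is_mult_by R N f q"
    unfolding ab(3) using ab(1,2) fv module_homD(1)[OF f] by (intro is_mult_byI) auto
  ultimately show ?thesis by blast
qed

text \<open>Every endomorphism given by a fraction yields a multiplier, and every multiplier is
  already realized by a central endomorphism. Hence any A between the center and the full
  endomorphism module has the same identified subset; the two extremes serve the dual and the ideals
  respectively.\<close>

lemma identified_subset_eq_multipliers:
  assumes N: "module R N" and tf: "torsion_free N"
    and A: "carrier (center_End R N) \<subseteq> carrier A" "carrier A \<subseteq> module_hom R N N"
    and P: "\<And>f q. f \<in> carrier A \<Longrightarrow> P f q \<longleftrightarrow> is_mult_by R N f q"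
  shows "identified_subset A P = multipliers N"
proof
  show "identified_subset A P \<subseteq> multipliers N"
    using A(2) P by (auto simp: identified_subset_def intro: is_mult_by_imp_multipliers)
  show "multipliers N \<subseteq> identified_subset A P"
    using multipliers_imp_center[OF N tf] A(1) P unfolding identified_subset_def by blast
qed

section \<open>Ideals containing a nonzerodivisor\<close>

lemma torsion_free_ideal_module:
  assumes "ideal I R"
  shows "torsion_free (ideal_module R I)"
  using nzd_cancel ideal.Icarr[OF assms] by (auto simp: torsion_free_def intro!: inj_onI)

lemma faithful_ideal_module:
  assumes I: "ideal I R" and x: "x \<in> I" "x \<in> nonzerodivisors R"
  shows "faithful (ideal_module R I)"
  unfolding faithful_def
proof (rule inj_onI)
  fix a c assume ac: "a \<in> carrier R" "c \<in> carrier R"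
    and "(\<lambda>v\<in>carrier (ideal_module R I). a \<odot>\<^bsub>ideal_module R I\<^esub> v)
      = (\<lambda>v\<in>carrier (ideal_module R I). c \<odot>\<^bsub>ideal_module R I\<^esub> v)"
  then have "a \<otimes> x = c \<otimes> x"
    using x(1) by (auto dest: fun_cong[where x = x])
  then show "a = c"
    using nzd_cancel[OF x(2) ac] ac nzd_closed[OF x(2)] by (simp add: m_comm)
qed

text \<open>Evaluating h(xy) in two ways gives x h(y) = h(x) y.\<close>

lemma End_ideal_is_mult_by:
  assumes I: "ideal I R" and x: "x \<in> I" "x \<in> nonzerodivisors R"
    and h: "h \<in> module_hom R (ideal_module R I) (ideal_module R I)"
  shows "is_mult_by R (ideal_module R I) h (fraction R (h x) x)"
proof (rule is_mult_byI)
  interpret I: ideal I R by (rule I)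
  note hD = module_homD[OF h, simplified]
  show "h x \<in> carrier R" using hD(1)[OF x(1)] by (rule I.Icarr)
  fix y assume "y \<in> carrier (ideal_module R I)"
  then have y: "y \<in> I" by simp
  then show "x \<odot>\<^bsub>ideal_module R I\<^esub> h y = h x \<odot>\<^bsub>ideal_module R I\<^esub> y"
    using hD(3)[of x y] hD(3)[of y x] hD(1)[of x] hD(1)[of y] x(1) I.Icarr
    by (simp add: m_comm)
qed (use x module_homD(1)[OF h] in auto)

text \<open>\<open>End_ideal_frac\<close> leaves the choice of nonzerodivisor open. Every choice
  represents h, and faithfulness makes the representing fraction unique, so h(x)/x is independent of
  x.\<close>

lemma End_ideal_frac_iff:
  assumes I: "ideal I R" and x: "x \<in> I" "x \<in> nonzerodivisors R"
    and h: "h \<in> module_hom R (ideal_module R I) (ideal_module R I)"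
  shows "End_ideal_frac R I h q \<longleftrightarrow> is_mult_by R (ideal_module R I) h q"
proof
  assume "End_ideal_frac R I h q"
  then show "is_mult_by R (ideal_module R I) h q"
    using End_ideal_is_mult_by[OF I _ _ h] by (auto simp: End_ideal_frac_def)
next
  assume "is_mult_by R (ideal_module R I) h q"
  moreover have "h \<in> carrier (ideal_module R I) \<rightarrow> carrier (ideal_module R I)"
    using module_homD(1)[OF h] by blast
  ultimately have "q = fraction R (h x) x"
    using is_mult_by_unique[OF module_ideal_module[OF I] faithful_ideal_module[OF I x]]
      End_ideal_is_mult_by[OF I x h] by blast
  then show "End_ideal_frac R I h q"
    using x by (auto simp: End_ideal_frac_def)
qed

lemma is_identification_End_ideal:
  assumes I: "ideal I R" and x: "x \<in> I" "x \<in> nonzerodivisors R"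
  shows "is_identification R (End_algebra R (ideal_module R I)) (End_ideal_frac R I)"
proof (rule is_identification_mult_by)
  show "module R (ideal_module R I)" by (rule module_ideal_module[OF I])
  then show "module R (End_algebra R (ideal_module R I))" by (rule module_End_algebra)
qed (use torsion_free_ideal_module[OF I] faithful_ideal_module[OF I x] End_ideal_is_mult_by[OF I x]
    End_ideal_frac_iff[OF I x] in auto)

lemma End_ideal_in_Q_eq_multipliers:
  assumes I: "ideal I R" and x: "x \<in> I" "x \<in> nonzerodivisors R"
  shows "End_ideal_in_Q R I = multipliers (ideal_module R I)"
  unfolding End_ideal_in_Q_def
  by (rule identified_subset_eq_multipliers[OF module_ideal_module[OF I] torsion_free_ideal_module[OF I]])
    (auto simp: mem_center_End_iff End_ideal_frac_iff[OF I x])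

text \<open>Cross-multiplication turns (a/b)(y/1) = z/1 into ay = bz, so the stabilizer of I in Q(R)
  is the divisibility condition of \<open>multipliers\<close>.\<close>

lemma multiplier_set_eq_multipliers:
  assumes I: "ideal I R"
  shows "multiplier_set R I = multipliers (ideal_module R I)"
proof -
  have iff: "fraction R a b \<otimes>\<^bsub>total_quotient R\<^esub> fraction R y \<one> = fraction R z \<one>
      \<longleftrightarrow> a \<otimes> y = b \<otimes> z"
    if "a \<in> carrier R" "b \<in> nonzerodivisors R" "y \<in> I" "z \<in> I" for a b y z
    using that nzd_closed[OF that(2)] ideal.Icarr[OF I]
    by (simp add: total_quotient_mult nzd_one fraction_eq_iff m_comm)
  show ?thesis
  proof (intro subset_antisym subsetI)
    fix q assume q: "q \<in> multiplier_set R I"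
    then obtain a b where ab: "a \<in> carrier R" "b \<in> nonzerodivisors R" "q = fraction R a b"
      by (auto simp: multiplier_set_def elim: total_quotientE)
    show "q \<in> multipliers (ideal_module R I)"
      unfolding ab(3)
    proof (rule multipliersI[OF ab(1,2)])
      fix y assume "y \<in> carrier (ideal_module R I)"
      then show "\<exists>z\<in>carrier (ideal_module R I).
          a \<odot>\<^bsub>ideal_module R I\<^esub> y = b \<odot>\<^bsub>ideal_module R I\<^esub> z"
        using q iff[OF ab(1,2)] by (auto simp: multiplier_set_def ab(3))
    qed
  next
    fix q assume "q \<in> multipliers (ideal_module R I)"
    then obtain a b where ab: "a \<in> carrier R" "b \<in> nonzerodivisors R" "q = fraction R a b"
      and div: "\<And>y. y \<in> I \<Longrightarrow> \<exists>z\<in>I. a \<otimes> y = b \<otimes> z"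
      by (auto elim!: multipliersE)
    show "q \<in> multiplier_set R I"
      using div iff[OF ab(1,2)] fraction_closed[OF ab(1,2)]
      by (auto simp: multiplier_set_def ab(3))
  qed
qed

section \<open>Trace ideals and dual modules\<close>

text \<open>Negatives come from the scalar -1 and right multiples from commutativity. The criterion
  serves the trace ideal and the auxiliary ideals compared with it.\<close>

lemma ideal_by_closure:
  assumes "I \<subseteq> carrier R" "\<zero> \<in> I" "\<And>x y. x \<in> I \<Longrightarrow> y \<in> I \<Longrightarrow> x \<oplus> y \<in> I"
    "\<And>r x. r \<in> carrier R \<Longrightarrow> x \<in> I \<Longrightarrow> r \<otimes> x \<in> I"
  shows "ideal I R"
proof (rule idealI)
  show "subgroup I (add_monoid R)"
  proof (rule add.subgroupI)
    fix x assume x: "x \<in> I"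
    then have "\<ominus> \<one> \<otimes> x \<in> I" by (intro assms(4)) auto
    then show "\<ominus> x \<in> I" using x assms(1) by (auto simp: l_minus)
  qed (use assms in auto)
  show "x \<otimes> r \<in> I" if "x \<in> I" "r \<in> carrier R" for x r
    using assms(4)[OF that(2,1)] that assms(1) by (auto simp: m_comm)
qed (use assms ring_axioms in auto)

lemma finsum_in_ideal:
  assumes "ideal J R" "finite F" "\<And>i. i \<in> F \<Longrightarrow> t i \<in> J"
  shows "finsum R t F \<in> J"
  using assms(2,3)
proof (induction F)
  case empty
  then show ?case
    using additive_subgroup.zero_closed[OF ideal.axioms(1)[OF assms(1)]] by simp
next
  case (insert i F)
  then show ?case
    using additive_subgroup.a_closed[OF ideal.axioms(1)[OF assms(1)]] ideal.Icarr[OF assms(1)]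
    by (subst finsum_insert) auto
qed

end

context module
begin

abbreviation dual where "dual \<equiv> dual_module R M"

abbreviation trace where "trace \<equiv> trace_ideal R M"

lemma dual_carrier: "carrier dual = module_hom R M (ideal_module R (carrier R))"
  by (simp add: dual_module_def)

lemma dual_simps:
  "m \<in> carrier M \<Longrightarrow> (\<alpha> \<oplus>\<^bsub>dual\<^esub> \<beta>) m = \<alpha> m \<oplus> \<beta> m"
  "m \<in> carrier M \<Longrightarrow> (r \<odot>\<^bsub>dual\<^esub> \<alpha>) m = r \<otimes> \<alpha> m"
  by (simp_all add: dual_module_def)

lemma dualD:
  assumes "\<alpha> \<in> carrier dual"
  shows "m \<in> carrier M \<Longrightarrow> \<alpha> m \<in> carrier R"
    and "m \<in> carrier M \<Longrightarrow> n \<in> carrier M \<Longrightarrow> \<alpha> (m \<oplus>\<^bsub>M\<^esub> n) = \<alpha> m \<oplus> \<alpha> n"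
    and "r \<in> carrier R \<Longrightarrow> m \<in> carrier M \<Longrightarrow> \<alpha> (r \<odot>\<^bsub>M\<^esub> m) = r \<otimes> \<alpha> m"
  using module_homD[OF assms[unfolded dual_carrier]] by auto

lemma dual_eqI:
  assumes "\<alpha> \<in> carrier dual" "\<beta> \<in> carrier dual" "\<And>m. m \<in> carrier M \<Longrightarrow> \<alpha> m = \<beta> m"
  shows "\<alpha> = \<beta>"
  using assms unfolding dual_carrier by (rule module_hom_eqI)

lemma module_dual: "module R dual"
  unfolding dual_module_def
  by (intro module_Hom_module module_ideal_module oneideal module_axioms)

lemma torsion_free_dual: "torsion_free dual"
  unfolding torsion_free_def
proof (intro ballI inj_onI)
  fix b \<alpha> \<beta> assume b: "b \<in> nonzerodivisors R" and \<alpha>: "\<alpha> \<in> carrier dual" and \<beta>: "\<beta> \<in> carrier dual"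
    and eq: "b \<odot>\<^bsub>dual\<^esub> \<alpha> = b \<odot>\<^bsub>dual\<^esub> \<beta>"
  show "\<alpha> = \<beta>"
  proof (rule dual_eqI[OF \<alpha> \<beta>])
    fix m assume m: "m \<in> carrier M"
    then have "b \<otimes> \<alpha> m = b \<otimes> \<beta> m" using eq by (metis dual_simps(2))
    then show "\<alpha> m = \<beta> m" using nzd_cancel[OF b] dualD(1)[OF \<alpha> m] dualD(1)[OF \<beta> m] by blast
  qed
qed

lemma dual_apply_in_trace:
  assumes "\<alpha> \<in> carrier dual" "m \<in> carrier M"
  shows "\<alpha> m \<in> trace"
  unfolding trace_ideal_def
  by (rule CollectI, intro exI[of _ "{\<alpha>}"] exI[of _ "\<lambda>_. \<alpha> m"])
    (use assms dualD(1)[OF assms] in auto)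

text \<open>This is the induction principle for trace elements: if the elements with some property
  form an ideal, the property only has to be checked on single values \<alpha>(m).\<close>

lemma trace_subset:
  assumes "ideal J R" "\<And>\<alpha> m. \<alpha> \<in> carrier dual \<Longrightarrow> m \<in> carrier M \<Longrightarrow> \<alpha> m \<in> J"
  shows "trace \<subseteq> J"
proof
  fix y assume "y \<in> trace"
  then obtain F t where F: "finite F" "F \<subseteq> carrier dual" "\<forall>\<alpha>\<in>F. t \<alpha> \<in> \<alpha> ` carrier M"
    and y: "y = finsum R t F"
    by (auto simp: trace_ideal_def)
  show "y \<in> J"
    unfolding y
  proof (rule finsum_in_ideal[OF assms(1) F(1)])
    fix \<alpha> assume \<alpha>: "\<alpha> \<in> F"
    then obtain m where "m \<in> carrier M" "t \<alpha> = \<alpha> m" using F(3) by blast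
    then show "t \<alpha> \<in> J" using assms(2) F(2) \<alpha> by auto
  qed
qed

text \<open>Two finite sums over different index sets are combined by padding both with
  \<open>0 = \<alpha>(0)\<close>.\<close>

lemma ideal_trace: "ideal trace R"
proof (rule ideal_by_closure)
  have zero: "\<zero> \<in> \<alpha> ` carrier M" if "\<alpha> \<in> carrier dual" for \<alpha>
    using dualD(3)[OF that, of \<zero> "\<zero>\<^bsub>M\<^esub>"] dualD(1)[OF that] by (intro image_eqI[of _ _ "\<zero>\<^bsub>M\<^esub>"]) auto
  show "trace \<subseteq> carrier R"
    by (rule trace_subset[OF oneideal]) (rule dualD(1))
  show "\<zero> \<in> trace"
    unfolding trace_ideal_def by (rule CollectI, intro exI[of _ "{}"]) auto
  show "r \<otimes> x \<in> trace" if r: "r \<in> carrier R" and xt: "x \<in> trace" for r x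
  proof -
    obtain F t where F: "finite F" "F \<subseteq> carrier dual" "\<forall>\<alpha>\<in>F. t \<alpha> \<in> \<alpha> ` carrier M"
      and x: "x = finsum R t F"
      using xt by (auto simp: trace_ideal_def)
    have t: "t \<in> F \<rightarrow> carrier R"
    proof
      fix \<alpha> assume \<alpha>: "\<alpha> \<in> F"
      then obtain m where "m \<in> carrier M" "t \<alpha> = \<alpha> m" using F(3) by blast
      then show "t \<alpha> \<in> carrier R" using dualD(1) F(2) \<alpha> by auto
    qed
    have "r \<otimes> x = (\<Oplus>\<alpha>\<in>F. r \<otimes> t \<alpha>)"
      unfolding x by (rule finsum_rdistr[OF F(1) r t])
    moreover have "\<forall>\<alpha>\<in>F. r \<otimes> t \<alpha> \<in> \<alpha> ` carrier M"
    proof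
      fix \<alpha> assume \<alpha>: "\<alpha> \<in> F"
      then obtain m where m: "m \<in> carrier M" "t \<alpha> = \<alpha> m" using F(3) by blast
      show "r \<otimes> t \<alpha> \<in> \<alpha> ` carrier M"
        using \<alpha> F(2) m r by (intro image_eqI[of _ _ "r \<odot>\<^bsub>M\<^esub> m"]) (auto simp: dualD(3))
    qed
    ultimately show ?thesis
      unfolding trace_ideal_def using F(1,2) by blast
  qed
  show "x \<oplus> y \<in> trace" if xt: "x \<in> trace" and yt: "y \<in> trace" for x y
  proof -
    obtain F t where F: "finite F" "F \<subseteq> carrier dual" "\<forall>\<alpha>\<in>F. t \<alpha> \<in> \<alpha> ` carrier M"
      and x: "x = finsum R t F"
      using xt by (auto simp: trace_ideal_def)
    obtain G u where G: "finite G" "G \<subseteq> carrier dual" "\<forall>\<alpha>\<in>G. u \<alpha> \<in> \<alpha> ` carrier M"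
      and y: "y = finsum R u G"
      using yt by (auto simp: trace_ideal_def)
    define t' where "t' = (\<lambda>\<alpha>. if \<alpha> \<in> F then t \<alpha> else \<zero>)"
    define u' where "u' = (\<lambda>\<alpha>. if \<alpha> \<in> G then u \<alpha> else \<zero>)"
    have img: "t' \<alpha> \<in> \<alpha> ` carrier M" "u' \<alpha> \<in> \<alpha> ` carrier M" if "\<alpha> \<in> F \<union> G" for \<alpha>
      using that F G zero by (auto simp: t'_def u'_def)
    moreover have "\<alpha> ` carrier M \<subseteq> carrier R" if "\<alpha> \<in> F \<union> G" for \<alpha>
      using dualD(1) that F(2) G(2) by auto
    ultimately have cl: "t' \<in> F \<union> G \<rightarrow> carrier R" "u' \<in> F \<union> G \<rightarrow> carrier R"
      by (meson Pi_I subsetD)+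
    have "x = finsum R t' (F \<union> G)"
      unfolding x using F G cl(1)
      by (intro R.add.finprod_mono_neutral_cong_left) (auto simp: t'_def)
    moreover have "y = finsum R u' (F \<union> G)"
      unfolding y using F G cl(2)
      by (intro R.add.finprod_mono_neutral_cong_left) (auto simp: u'_def)
    ultimately have "x \<oplus> y = (\<Oplus>\<alpha>\<in>F \<union> G. t' \<alpha> \<oplus> u' \<alpha>)"
      using cl by (simp add: R.finsum_addf)
    moreover have "\<forall>\<alpha>\<in>F \<union> G. t' \<alpha> \<oplus> u' \<alpha> \<in> \<alpha> ` carrier M"
    proof
      fix \<alpha> assume \<alpha>: "\<alpha> \<in> F \<union> G"
      obtain m n where mn: "m \<in> carrier M" "t' \<alpha> = \<alpha> m" "n \<in> carrier M" "u' \<alpha> = \<alpha> n"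
        using img[OF \<alpha>] by blast
      \<comment> \<open>The sums in \<open>trace_ideal\<close> carry one term per functional, so the
        two terms belonging to \<alpha> are merged into the value at m + n.\<close>
      show "t' \<alpha> \<oplus> u' \<alpha> \<in> \<alpha> ` carrier M"
        using \<alpha> F(2) G(2) mn by (intro image_eqI[of _ _ "m \<oplus>\<^bsub>M\<^esub> n"]) (auto simp: dualD(2))
    qed
    ultimately show ?thesis
      unfolding trace_ideal_def using F(1,2) G(1,2) by blast
  qed
qed

text \<open>Operations on the dual are pointwise, so evaluation at m is linear. These evaluations
  are the functionals on the dual that show its trace to contain the trace of M.\<close>

lemma evaluation_in_bidual:
  assumes "m \<in> carrier M"
  shows "(\<lambda>\<alpha>\<in>carrier dual. \<alpha> m) \<in> carrier (dual_module R dual)"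
proof -
  interpret D: module R dual by (rule module_dual)
  show ?thesis
    unfolding D.dual_carrier
    by (rule module_homI) (use assms dualD in \<open>auto simp: dual_simps\<close>)
qed

text \<open>Each generator \<alpha>(m) is also the value at \<alpha> of the functional evaluating at
  m.\<close>

lemma trace_subset_trace_dual: "trace \<subseteq> trace_ideal R dual"
proof -
  interpret D: module R dual by (rule module_dual)
  show ?thesis
  proof (rule trace_subset[OF D.ideal_trace])
    fix \<alpha> m assume "\<alpha> \<in> carrier dual" "m \<in> carrier M"
    then show "\<alpha> m \<in> trace_ideal R dual"
      using D.dual_apply_in_trace[OF evaluation_in_bidual] by force
  qed
qed

text \<open>The y with ay in bK form an ideal, so divisibility on the values \<alpha>(m) extends to
  the whole trace.\<close>

lemma trace_divI:
  assumes a: "a \<in> carrier R" and b: "b \<in> carrier R" and K: "ideal K R"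
    and div: "\<And>\<alpha> m. \<alpha> \<in> carrier dual \<Longrightarrow> m \<in> carrier M \<Longrightarrow> \<exists>z\<in>K. a \<otimes> \<alpha> m = b \<otimes> z"
    and y: "y \<in> trace"
  shows "\<exists>z\<in>K. a \<otimes> y = b \<otimes> z"
proof -
  interpret K: ideal K R by (rule K)
  have "ideal {y \<in> carrier R. \<exists>z\<in>K. a \<otimes> y = b \<otimes> z} R"
  proof (rule ideal_by_closure)
    fix x y assume "x \<in> {y \<in> carrier R. \<exists>z\<in>K. a \<otimes> y = b \<otimes> z}" "y \<in> {y \<in> carrier R. \<exists>z\<in>K. a \<otimes> y = b \<otimes> z}"
    then obtain z w where "x \<in> carrier R" "y \<in> carrier R" "z \<in> K" "w \<in> K"
      "a \<otimes> x = b \<otimes> z" "a \<otimes> y = b \<otimes> w"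
      by auto
    then show "x \<oplus> y \<in> {y \<in> carrier R. \<exists>z\<in>K. a \<otimes> y = b \<otimes> z}"
      using a b by (auto intro!: bexI[of _ "z \<oplus> w"] simp: r_distr K.Icarr)
  next
    fix r x assume r: "r \<in> carrier R" and "x \<in> {y \<in> carrier R. \<exists>z\<in>K. a \<otimes> y = b \<otimes> z}"
    then obtain z where x: "x \<in> carrier R" "z \<in> K" "a \<otimes> x = b \<otimes> z"
      by auto
    have "a \<otimes> (r \<otimes> x) = r \<otimes> (a \<otimes> x)" by (rule m_lcomm[OF a r x(1)])
    also have "\<dots> = b \<otimes> (r \<otimes> z)" using b r x by (simp add: m_lcomm K.Icarr)
    finally show "r \<otimes> x \<in> {y \<in> carrier R. \<exists>z\<in>K. a \<otimes> y = b \<otimes> z}"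
      using r x K.I_l_closed by auto
  qed (use a b in \<open>auto intro!: bexI[of _ \<zero>]\<close>)
  then have "trace \<subseteq> {y \<in> carrier R. \<exists>z\<in>K. a \<otimes> y = b \<otimes> z}"
    using div dualD(1) by (intro trace_subset) auto
  then show ?thesis using y by blast
qed

section \<open>Faithfulness of the dual and its central endomorphisms\<close>

lemma faithful_dual:
  assumes x: "x \<in> trace" "x \<in> nonzerodivisors R"
  shows "faithful dual"
  unfolding faithful_def
proof (rule inj_onI)
  fix a c assume ac: "a \<in> carrier R" "c \<in> carrier R"
    and eq: "(\<lambda>\<alpha>\<in>carrier dual. a \<odot>\<^bsub>dual\<^esub> \<alpha>) = (\<lambda>\<alpha>\<in>carrier dual. c \<odot>\<^bsub>dual\<^esub> \<alpha>)"
  have "(a \<ominus> c) \<otimes> \<alpha> m = \<zero>" if \<alpha>: "\<alpha> \<in> carrier dual" and m: "m \<in> carrier M" for \<alpha> m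
  proof -
    have "a \<odot>\<^bsub>dual\<^esub> \<alpha> = c \<odot>\<^bsub>dual\<^esub> \<alpha>" using fun_cong[OF eq, of \<alpha>] \<alpha> by simp
    then have "a \<otimes> \<alpha> m = c \<otimes> \<alpha> m" using m by (metis dual_simps(2))
    then show ?thesis
      using ac dualD(1)[OF \<alpha> m] by (simp add: a_minus_def l_distr l_minus R.r_neg)
  qed
  \<comment> \<open>With b = 0 and K = {0} the divisibility statement of \<open>trace_divI\<close>
    says annihilation: a - c kills the trace, in particular its nonzerodivisor x.\<close>
  then have "\<exists>z\<in>{\<zero>}. (a \<ominus> c) \<otimes> x = \<zero> \<otimes> z"
    using ac by (intro trace_divI[OF _ _ zeroideal _ x(1)]) auto
  then have "x \<otimes> (a \<ominus> c) = \<zero>"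
    using ac nzd_closed[OF x(2)] by (simp add: m_comm)
  then have "a \<ominus> c = \<zero>"
    using x(2) ac unfolding nonzerodivisors_def by simp
  then show "a = c" using ac by simp
qed

text \<open>For \<open>\<alpha>, \<beta> \<in> M\<^sup>*\<close> and \<open>m \<in> M\<close>, a central \<open>f\<close> commutes with the endomorphism
  \<open>\<gamma> \<mapsto> \<gamma>(m) \<beta>\<close>, so that \<open>\<alpha>(m) f(\<beta>) = f(\<alpha>)(m) \<beta>\<close>.\<close>

lemma center_End_dual_swap:
  assumes f: "f \<in> carrier (center_End R dual)"
    and \<alpha>: "\<alpha> \<in> carrier dual" and \<beta>: "\<beta> \<in> carrier dual" and m: "m \<in> carrier M"
  shows "\<alpha> m \<odot>\<^bsub>dual\<^esub> f \<beta> = f \<alpha> m \<odot>\<^bsub>dual\<^esub> \<beta>"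
proof -
  interpret D: module R dual by (rule module_dual)
  have hom: "f \<in> module_hom R dual dual" using f by (simp add: mem_center_End_iff)
  define s where "s = (\<lambda>\<gamma>\<in>carrier dual. \<gamma> m \<odot>\<^bsub>dual\<^esub> \<beta>)"
  have "s \<in> module_hom R dual dual"
  proof (rule module_homI)
    show "s \<in> carrier dual \<rightarrow>\<^sub>E carrier dual"
      using dualD(1)[OF _ m] \<beta> by (auto simp: s_def)
  qed (use dualD(1)[OF _ m] \<beta> m in
      \<open>auto simp: s_def dual_simps D.smult_l_distr D.smult_assoc1\<close>)
  then have "f (s \<alpha>) = s (f \<alpha>)"
    using f \<alpha> by (simp add: mem_center_End_iff)
  then show ?thesis
    using \<alpha> \<beta> module_homD(1)[OF hom \<alpha>] module_homD(3)[OF hom dualD(1)[OF \<alpha> m] \<beta>]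
    by (simp add: s_def)
qed

text \<open>The ideal \<open>?J\<close> of all y for which y f acts as an element of R replaces an
  explicit sum for x. It contains the generators of the trace, hence x, and then f is multiplication
  by z/x for the corresponding z.\<close>

lemma center_End_dual_is_mult_by:
  assumes x: "x \<in> trace" "x \<in> nonzerodivisors R" and f: "f \<in> carrier (center_End R dual)"
  shows "\<exists>q. is_mult_by R dual f q"
proof -
  interpret D: module R dual by (rule module_dual)
  have hom: "f \<in> module_hom R dual dual" using f by (simp add: mem_center_End_iff)
  note fD = module_homD(1)[OF hom]
  let ?J = "{y \<in> carrier R. \<exists>z\<in>carrier R. \<forall>\<beta>\<in>carrier dual. y \<odot>\<^bsub>dual\<^esub> f \<beta> = z \<odot>\<^bsub>dual\<^esub> \<beta>}"
  have "ideal ?J R"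
  proof (rule ideal_by_closure)
    fix y y' assume "y \<in> ?J" "y' \<in> ?J"
    then obtain z z' where z: "y \<in> carrier R" "y' \<in> carrier R" "z \<in> carrier R" "z' \<in> carrier R"
      "\<And>\<beta>. \<beta> \<in> carrier dual \<Longrightarrow> y \<odot>\<^bsub>dual\<^esub> f \<beta> = z \<odot>\<^bsub>dual\<^esub> \<beta>"
      "\<And>\<beta>. \<beta> \<in> carrier dual \<Longrightarrow> y' \<odot>\<^bsub>dual\<^esub> f \<beta> = z' \<odot>\<^bsub>dual\<^esub> \<beta>"
      by auto
    then show "y \<oplus> y' \<in> ?J"
      by (auto intro!: bexI[of _ "z \<oplus> z'"] simp: D.smult_l_distr fD)
  next
    fix r y assume r: "r \<in> carrier R" and "y \<in> ?J"
    then obtain z where z: "y \<in> carrier R" "z \<in> carrier R"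
      "\<And>\<beta>. \<beta> \<in> carrier dual \<Longrightarrow> y \<odot>\<^bsub>dual\<^esub> f \<beta> = z \<odot>\<^bsub>dual\<^esub> \<beta>"
      by auto
    then show "r \<otimes> y \<in> ?J"
      using r by (auto intro!: bexI[of _ "r \<otimes> z"] simp: D.smult_assoc1 fD)
  qed (auto intro!: bexI[of _ \<zero>] simp: fD)
  \<comment> \<open>The element of R acting as \<alpha>(m) f is \<open>f \<alpha> m\<close>, by
    \<open>center_End_dual_swap\<close>.\<close>
  moreover have "\<alpha> m \<in> ?J" if "\<alpha> \<in> carrier dual" "m \<in> carrier M" for \<alpha> m
    using that center_End_dual_swap[OF f that(1) _ that(2)] dualD(1) fD
    by (auto intro!: bexI[of _ "f \<alpha> m"])
  ultimately have "x \<in> ?J" using trace_subset x(1) by blast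
  then obtain z where "z \<in> carrier R"
    and "\<And>\<beta>. \<beta> \<in> carrier dual \<Longrightarrow> x \<odot>\<^bsub>dual\<^esub> f \<beta> = z \<odot>\<^bsub>dual\<^esub> \<beta>"
    by auto
  then have "is_mult_by R dual f (fraction R z x)"
    using x(2) fD by (intro is_mult_byI) auto
  then show ?thesis ..
qed

lemma is_identification_center_End_dual:
  assumes x: "x \<in> trace" "x \<in> nonzerodivisors R"
  shows "is_identification R (center_End R dual) (is_mult_by R dual)"
  using center_End_dual_is_mult_by[OF x]
  by (intro is_identification_mult_by[OF module_dual torsion_free_dual faithful_dual[OF x]]
      module_center_End[OF module_dual]) (auto simp: mem_center_End_iff)

lemma center_End_in_Q_dual: "center_End_in_Q R dual = multipliers dual"
  unfolding center_End_in_Q_def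
  by (rule identified_subset_eq_multipliers[OF module_dual torsion_free_dual])
    (auto simp: mem_center_End_iff)

section \<open>Comparison of the multipliers of the dual and of the two trace ideals\<close>

lemma multipliers_dual_subset_trace: "multipliers dual \<subseteq> multipliers (ideal_module R trace)"
proof
  fix q assume "q \<in> multipliers dual"
  then obtain a b where ab: "a \<in> carrier R" "b \<in> nonzerodivisors R" "q = fraction R a b"
    and div: "\<And>\<alpha>. \<alpha> \<in> carrier dual \<Longrightarrow> \<exists>\<beta>\<in>carrier dual. a \<odot>\<^bsub>dual\<^esub> \<alpha> = b \<odot>\<^bsub>dual\<^esub> \<beta>"
    by (rule multipliersE) (rule that)
  have "\<exists>z\<in>trace. a \<otimes> y = b \<otimes> z" if "y \<in> trace" for y
  proof (rule trace_divI[OF ab(1) nzd_closed[OF ab(2)] ideal_trace _ that])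
    fix \<alpha> m assume \<alpha>: "\<alpha> \<in> carrier dual" and m: "m \<in> carrier M"
    obtain \<beta> where \<beta>: "\<beta> \<in> carrier dual" "a \<odot>\<^bsub>dual\<^esub> \<alpha> = b \<odot>\<^bsub>dual\<^esub> \<beta>" using div[OF \<alpha>] by blast
    \<comment> \<open>Evaluating a \<alpha> = b \<beta> at m divides the value by b, with a quotient
      \<beta>(m) that again lies in the trace.\<close>
    have "a \<otimes> \<alpha> m = b \<otimes> \<beta> m" using \<beta>(2) m by (metis dual_simps(2))
    then show "\<exists>z\<in>trace. a \<otimes> \<alpha> m = b \<otimes> z" using dual_apply_in_trace[OF \<beta>(1) m] by blast
  qed
  then show "q \<in> multipliers (ideal_module R trace)"
    unfolding ab(3) by (intro multipliersI ab) auto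
qed

text \<open>Here the argument is divided instead of the functional: am = bn gives a \<alpha>(m) = b
  \<alpha>(n). Applied with the dual in place of M, it lets multipliers of the dual act on the trace
  of the dual.\<close>

lemma multipliers_subset_trace: "multipliers M \<subseteq> multipliers (ideal_module R trace)"
proof
  fix q assume "q \<in> multipliers M"
  then obtain a b where ab: "a \<in> carrier R" "b \<in> nonzerodivisors R" "q = fraction R a b"
    and div: "\<And>m. m \<in> carrier M \<Longrightarrow> \<exists>n\<in>carrier M. a \<odot>\<^bsub>M\<^esub> m = b \<odot>\<^bsub>M\<^esub> n"
    by (rule multipliersE) (rule that)
  note bR = nzd_closed[OF ab(2)]
  have "\<exists>z\<in>trace. a \<otimes> y = b \<otimes> z" if "y \<in> trace" for y
  proof (rule trace_divI[OF ab(1) bR ideal_trace _ that])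
    fix \<alpha> m assume \<alpha>: "\<alpha> \<in> carrier dual" and m: "m \<in> carrier M"
    obtain n where n: "n \<in> carrier M" "a \<odot>\<^bsub>M\<^esub> m = b \<odot>\<^bsub>M\<^esub> n" using div[OF m] by blast
    have "a \<otimes> \<alpha> m = b \<otimes> \<alpha> n"
      using arg_cong[OF n(2), of \<alpha>] ab(1) bR m n(1) by (simp add: dualD(3)[OF \<alpha>])
    then show "\<exists>z\<in>trace. a \<otimes> \<alpha> m = b \<otimes> z" using dual_apply_in_trace[OF \<alpha> n(1)] by blast
  qed
  then show "q \<in> multipliers (ideal_module R trace)"
    unfolding ab(3) by (intro multipliersI ab) auto
qed

text \<open>Values of functionals lie in I, so a \<alpha>(m) is divisible by b in R and
  \<open>quotient_hom\<close> divides a \<alpha> by b inside the dual. Allowing any ideal above the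
  trace covers the trace ideals of both M and its dual.\<close>

lemma multipliers_ideal_subset_dual:
  assumes I: "ideal I R" and sub: "trace \<subseteq> I"
  shows "multipliers (ideal_module R I) \<subseteq> multipliers dual"
proof
  fix q assume "q \<in> multipliers (ideal_module R I)"
  then obtain a b where ab: "a \<in> carrier R" "b \<in> nonzerodivisors R" "q = fraction R a b"
    and div: "\<And>y. y \<in> I \<Longrightarrow> \<exists>z\<in>I. a \<otimes> y = b \<otimes> z"
    by (auto elim!: multipliersE)
  show "q \<in> multipliers dual"
    unfolding ab(3)
  proof (rule multipliersI[OF ab(1,2)])
    fix \<alpha> assume \<alpha>: "\<alpha> \<in> carrier dual"
    let ?S = "ideal_module R (carrier R)"
    have "\<exists>\<beta>\<in>module_hom R M ?S. \<forall>m\<in>carrier M. b \<odot>\<^bsub>?S\<^esub> \<beta> m = a \<odot>\<^bsub>?S\<^esub> \<alpha> m"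
    proof (rule quotient_hom[OF module_axioms module_ideal_module[OF oneideal]
          torsion_free_ideal_module[OF oneideal] ab(1,2) \<alpha>[unfolded dual_carrier]])
      fix m assume "m \<in> carrier M"
      then have "\<alpha> m \<in> I" using dual_apply_in_trace[OF \<alpha>] sub by blast
      then show "\<exists>z\<in>carrier ?S. a \<odot>\<^bsub>?S\<^esub> \<alpha> m = b \<odot>\<^bsub>?S\<^esub> z"
        using div ideal.Icarr[OF I] by fastforce
    qed
    then obtain \<beta> where \<beta>: "\<beta> \<in> carrier dual" "\<And>m. m \<in> carrier M \<Longrightarrow> b \<otimes> \<beta> m = a \<otimes> \<alpha> m"
      unfolding dual_carrier by auto
    have "a \<odot>\<^bsub>dual\<^esub> \<alpha> = b \<odot>\<^bsub>dual\<^esub> \<beta>"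
      using \<beta>(2) by (simp add: dual_module_def cong: restrict_cong)
    then show "\<exists>\<beta>\<in>carrier dual. a \<odot>\<^bsub>dual\<^esub> \<alpha> = b \<odot>\<^bsub>dual\<^esub> \<beta>" using \<beta>(1) by blast
  qed
qed

lemma multipliers_trace: "multipliers (ideal_module R trace) = multipliers dual"
  using multipliers_ideal_subset_dual[OF ideal_trace] multipliers_dual_subset_trace by blast

text \<open>One inclusion is \<open>multipliers_subset_trace\<close> for the dual. The other uses
  that the trace of M lies in the trace of its dual, so division of functionals on M still
  applies.\<close>

lemma multipliers_trace_dual:
  "multipliers (ideal_module R (trace_ideal R dual)) = multipliers dual"
proof -
  interpret D: module R dual by (rule module_dual)
  show ?thesis
    using multipliers_ideal_subset_dual[OF D.ideal_trace trace_subset_trace_dual]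
      D.multipliers_subset_trace by blast
qed

end

section \<open>The identifications and the equality of the three subsets of Q(R)\<close>

theorem corollary3p24:
  fixes R :: "('a, 'r) ring_scheme" and M :: "('a, 'b, 'm) module_scheme"
  assumes "cring R" and "noetherian_ring R"
    and "module R M" and "fin_gen_module R M"
    and "0 < grade R (trace_ideal R M)"
  shows "is_identification R (End_algebra R (ideal_module R (trace_ideal R M)))
        (End_ideal_frac R (trace_ideal R M))
    \<and> is_identification R (End_algebra R (ideal_module R (trace_ideal R (dual_module R M))))
        (End_ideal_frac R (trace_ideal R (dual_module R M)))
    \<and> is_identification R (center_End R (dual_module R M)) (is_mult_by R (dual_module R M))
    \<and> End_ideal_in_Q R (trace_ideal R M)
        = multiplier_set R (trace_ideal R M)
    \<and> End_ideal_in_Q R (trace_ideal R (dual_module R M))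
        = multiplier_set R (trace_ideal R (dual_module R M))
    \<and> submodule (End_ideal_in_Q R (trace_ideal R M)) R (total_quotient R)
    \<and> submodule (End_ideal_in_Q R (trace_ideal R (dual_module R M))) R (total_quotient R)
    \<and> submodule (center_End_in_Q R (dual_module R M)) R (total_quotient R)
    \<and> center_End_in_Q R (dual_module R M) = End_ideal_in_Q R (trace_ideal R M)
    \<and> End_ideal_in_Q R (trace_ideal R M) = End_ideal_in_Q R (trace_ideal R (dual_module R M))"
proof -
  interpret module R M by fact
  interpret D: module R dual by (rule module_dual)
  obtain x where x: "x \<in> trace" "x \<in> nonzerodivisors R"
    using grade_pos_imp_nzd[OF ideal_trace assms(5)] by blast
  \<comment> \<open>The nonzerodivisor supplied by positive grade serves for both trace
    ideals.\<close>
  then have x': "x \<in> D.trace" using trace_subset_trace_dual by blast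
  note ident = is_identification_End_ideal[OF ideal_trace x]
    is_identification_End_ideal[OF D.ideal_trace x' x(2)]
    is_identification_center_End_dual[OF x]
  note End_eq = End_ideal_in_Q_eq_multipliers[OF ideal_trace x]
    End_ideal_in_Q_eq_multipliers[OF D.ideal_trace x' x(2)]
  have "submodule (End_ideal_in_Q R trace) R (total_quotient R)"
    "submodule (End_ideal_in_Q R D.trace) R (total_quotient R)"
    "submodule (center_End_in_Q R dual) R (total_quotient R)"
    unfolding End_ideal_in_Q_def center_End_in_Q_def
    by (intro submodule_identified_subset ident)+
  moreover have "End_ideal_in_Q R trace = multiplier_set R trace"
    "End_ideal_in_Q R D.trace = multiplier_set R D.trace"
    using End_eq by (simp_all add: multiplier_set_eq_multipliers ideal_trace D.ideal_trace)
  moreover have "center_End_in_Q R dual = End_ideal_in_Q R trace"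
    "End_ideal_in_Q R trace = End_ideal_in_Q R D.trace"
    using End_eq by (simp_all add: center_End_in_Q_dual multipliers_trace multipliers_trace_dual)
  ultimately show ?thesis using ident by blast
qed

end
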